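(* Let $S$ and $T$ be totally ordered sets and let $P=S\times T$ with the product order. Every pointwise finite-dimensional middle exact persistence module $M\colon P\to\mathbf{Vec}$ is isomorphic to a direct sum of block modules $k_B$, $B\subseteq P$ a block.
   Context: Persistence modules over a poset are functors to $k$-vector spaces (poset viewed as a category with one morphism $p\to q$ iff $p\le q$), with structure maps $M(p\le q)$; pointwise finite-dimensional means each $M_p$ is finite-dimensional. $P=S\times T$ has $(x,y)\le(x',y')$ iff $x\le x'$ and $y\le y'$. $M$ is middle exact if for all $x\le x'$ in $S$ and $y\le y'$ in $T$, with $a=(x,y)$, $b=(x,y')$, $c=(x',y)$, $d=(x',y')$, the sequence $M_a\xrightarrow{(M(a\le b),\,M(a\le c))} M_b\oplus M_c\xrightarrow{M(b\le d)-M(c\le d)} M_d$ is exact at $M_b\oplus M_c$. An interval ideal of a totally ordered set is a non-empty subset closed downwards; an interval filter is a non-empty subset closed upwards; an interval is a non-empty convex subset. A non-empty subset $B\subseteq P$ is a block if it is of one of the forms: (db) $J_S\times J_T$ with $J_S,J_T$ interval ideals; (bb) $J_S\times J_T$ with $J_S,J_T$ interval filters; (vb) $J_S\times T$ with $J_S$ an interval; (hb) $S\times J_T$ with $J_T$ an interval. For a subset $B$, $k_B$ denotes the module with $(k_B)_p=k$ for $p\in B$, $0$ otherwise, and $k_B(p\le q)=\mathrm{id}_k$ if $p,q\in B$, zero otherwise. *)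

theory Defs
  imports Complex_Main "HOL-Library.Function_Algebras" "HOL-Library.Product_Order"
begin

definition lin_on :: "('k \<Rightarrow> 'v::ab_group_add \<Rightarrow> 'v) \<Rightarrow> ('k \<Rightarrow> 'w::ab_group_add \<Rightarrow> 'w)
    \<Rightarrow> 'v set \<Rightarrow> ('v \<Rightarrow> 'w) \<Rightarrow> bool" where
  "lin_on s1 s2 A h \<longleftrightarrow>
     (\<forall>x\<in>A. \<forall>y\<in>A. h (x + y) = h x + h y) \<and> (\<forall>c. \<forall>x\<in>A. h (s1 c x) = s2 c (h x))"

definition pmod :: "('k::field \<Rightarrow> 'v::ab_group_add \<Rightarrow> 'v) \<Rightarrow> ('p::order \<Rightarrow> 'v set)
    \<Rightarrow> ('p \<Rightarrow> 'p \<Rightarrow> 'v \<Rightarrow> 'v) \<Rightarrow> bool" where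
  "pmod s M f \<longleftrightarrow> vector_space s \<and> (\<forall>p. Modules.module.subspace s (M p)) \<and>
     (\<forall>p q. p \<le> q \<longrightarrow> f p q ` M p \<subseteq> M q \<and> lin_on s s (M p) (f p q)) \<and>
     (\<forall>p. \<forall>x\<in>M p. f p p x = x) \<and>
     (\<forall>p q r. p \<le> q \<longrightarrow> q \<le> r \<longrightarrow> (\<forall>x\<in>M p. f q r (f p q x) = f p r x))"

definition pfd :: "('k::field \<Rightarrow> 'v::ab_group_add \<Rightarrow> 'v) \<Rightarrow> ('p \<Rightarrow> 'v set) \<Rightarrow> bool" where
  "pfd s M \<longleftrightarrow> (\<forall>p. \<exists>B. finite B \<and> B \<subseteq> M p \<and> Modules.module.span s B = M p)"

definition middle_exact :: "('s::order \<times> 't::order \<Rightarrow> 'v::ab_group_add set)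
    \<Rightarrow> ('s \<times> 't \<Rightarrow> 's \<times> 't \<Rightarrow> 'v \<Rightarrow> 'v) \<Rightarrow> bool" where
  "middle_exact M f \<longleftrightarrow>
     (\<forall>x x' y y'. x \<le> x' \<longrightarrow> y \<le> y' \<longrightarrow>
        (let a = (x, y); b = (x, y'); c = (x', y); d = (x', y') in
          {(u, v). u \<in> M b \<and> v \<in> M c \<and> f b d u - f c d v = 0}
            = (\<lambda>w. (f a b w, f a c w)) ` M a))"

definition interval_ideal :: "'a::order set \<Rightarrow> bool" where
  "interval_ideal J \<longleftrightarrow> J \<noteq> {} \<and> (\<forall>x y. y \<in> J \<longrightarrow> x \<le> y \<longrightarrow> x \<in> J)"

definition interval_filter :: "'a::order set \<Rightarrow> bool" where
  "interval_filter J \<longleftrightarrow> J \<noteq> {} \<and> (\<forall>x y. x \<in> J \<longrightarrow> x \<le> y \<longrightarrow> y \<in> J)"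

definition interval :: "'a::order set \<Rightarrow> bool" where
  "interval J \<longleftrightarrow> J \<noteq> {} \<and> (\<forall>x y z. x \<in> J \<longrightarrow> z \<in> J \<longrightarrow> x \<le> y \<longrightarrow> y \<le> z \<longrightarrow> y \<in> J)"

definition is_block :: "('s::order \<times> 't::order) set \<Rightarrow> bool" where
  "is_block B \<longleftrightarrow> B \<noteq> {} \<and>
     ((\<exists>JS JT. interval_ideal JS \<and> interval_ideal JT \<and> B = JS \<times> JT) \<or>
      (\<exists>JS JT. interval_filter JS \<and> interval_filter JT \<and> B = JS \<times> JT) \<or>
      (\<exists>JS. interval JS \<and> B = JS \<times> UNIV) \<or>
      (\<exists>JT. interval JT \<and> B = UNIV \<times> JT))"

text \<open>The direct sum of the block modules k_(blk i), i \<in> I: at p, the finitely supported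
  families (x i) with x i = 0 unless i \<in> I and p \<in> blk i; componentwise scalar
  multiplication; structure map p \<le> q is the identity on components with q \<in> blk i and
  zero on the others (i.e. the direct sum of the structure maps of the k_(blk i)).\<close>
definition dsum_scale :: "'k::field \<Rightarrow> ('i \<Rightarrow> 'k) \<Rightarrow> ('i \<Rightarrow> 'k)" where
  "dsum_scale c x = (\<lambda>i. c * x i)"

definition dsum_space :: "'i set \<Rightarrow> ('i \<Rightarrow> 'p set) \<Rightarrow> 'p \<Rightarrow> ('i \<Rightarrow> 'k::field) set" where
  "dsum_space I blk p =
     {x. finite {i. x i \<noteq> 0} \<and> (\<forall>i. x i \<noteq> 0 \<longrightarrow> i \<in> I \<and> p \<in> blk i)}"

definition dsum_map :: "('i \<Rightarrow> 'p set) \<Rightarrow> 'p \<Rightarrow> 'p \<Rightarrow> ('i \<Rightarrow> 'k::field) \<Rightarrow> ('i \<Rightarrow> 'k)" where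
  "dsum_map blk p q x = (\<lambda>i. if q \<in> blk i then x i else 0)"

definition pmod_iso :: "('k \<Rightarrow> 'v::ab_group_add \<Rightarrow> 'v) \<Rightarrow> ('p::order \<Rightarrow> 'v set) \<Rightarrow> ('p \<Rightarrow> 'p \<Rightarrow> 'v \<Rightarrow> 'v)
    \<Rightarrow> ('k \<Rightarrow> 'w::ab_group_add \<Rightarrow> 'w) \<Rightarrow> ('p \<Rightarrow> 'w set) \<Rightarrow> ('p \<Rightarrow> 'p \<Rightarrow> 'w \<Rightarrow> 'w)
    \<Rightarrow> ('p \<Rightarrow> 'v \<Rightarrow> 'w) \<Rightarrow> bool" where
  "pmod_iso s1 M f s2 N g \<phi> \<longleftrightarrow>
     (\<forall>p. bij_betw (\<phi> p) (M p) (N p) \<and> lin_on s1 s2 (M p) (\<phi> p)) \<and>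
     (\<forall>p q. p \<le> q \<longrightarrow> (\<forall>x\<in>M p. \<phi> q (f p q x) = g p q (\<phi> p x)))"

end

theory Submission
  imports Defs
begin

text \<open>It suffices that every non-zero pointwise finite-dimensional middle exact module has a block
  module as a direct summand: by Zorn's lemma there is a maximal pair of an independent family of
  block summands and a complement (along a chain, the complements stabilise at each point), and a
  non-zero complement, being middle exact again, would split further.

  A block module is a summand as soon as there is an element \<open>z\<close> at some point \<open>p\<close> of a rectangle
  \<open>B\<close> that lifts to every smaller point of \<open>B\<close> by an element dying outside \<open>B\<close>, and whose images in
  \<open>B\<close> are not sums of elements coming from outside \<open>B\<close>: the lifts can be chosen coherently since
  codirected systems of non-empty finite-dimensional affine spaces have sections, and a submodule
  maximal among those avoiding the coherent family is a complement, since \<open>B\<close> is directed.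

  Such a \<open>z\<close> is found as follows. If some non-zero element dies both horizontally and vertically,
  there is a death block. Otherwise, if some element dies horizontally (vertically), there is a
  vertical (horizontal) band. Otherwise all maps are injective, and there is a birth block.\<close>

section \<open>Affine subspaces and sections of codirected systems\<close>

text \<open>\<open>S\<close> and \<open>T\<close> are arbitrary total orders, so a block may have no
  first or last row or column and no countable sequence approaching its edge. Neither a generator at
  an extremal point nor a recursive choice of lifts is therefore available. Finite dimension
  replaces both through one principle: a non-empty family of affine subspaces of a single
  \<open>M p\<close> has a minimal member. It makes infinite intersections attained, and among the
  kernels towards infinitely many points it provides a least one. Affine rather than linear
  subspaces are needed because the lifts of a fixed non-zero element do not contain zero.

  The second obstacle is that middle exactness provides lifts without uniqueness. A smallest
  non-zero kernel or image removes the ambiguity: the error of a lift lies in a strictly smaller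
  member of the same chain of subspaces, hence vanishes. This is the role of the fact
  \<open>trivial\<close> in each of the three block constructions.\<close>

definition flat :: "('k \<Rightarrow> 'v::ab_group_add \<Rightarrow> 'v) \<Rightarrow> 'v set \<Rightarrow> bool" where
  "flat s A \<longleftrightarrow> A \<noteq> {} \<and> (\<forall>x\<in>A. \<forall>y\<in>A. \<forall>z\<in>A. \<forall>c. x + s c (y - z) \<in> A)"

context vector_space
begin

text \<open>A basis of \<open>U\<close> extended by a vector outside \<open>U\<close> is still
  independent and fits into the span of a basis of \<open>V\<close>. The finite \<open>B\<close>
  matters because \<open>dim\<close> counts by \<open>card\<close>, which is zero for an infinite
  basis.\<close>

lemma dim_strict_mono:
  assumes "subspace U" "U \<subset> V" "V \<subseteq> span B" "finite B"
  shows "dim U < dim V"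
proof -
  obtain b where b: "b \<subseteq> U" "independent b" "U \<subseteq> span b" "card b = dim U"
    using basis_exists by blast
  obtain c where c: "c \<subseteq> V" "independent c" "V \<subseteq> span c" "card c = dim V"
    using basis_exists by blast
  obtain v where v: "v \<in> V" "v \<notin> U"
    using assms(2) by blast
  have finc: "finite c"
    using independent_span_bound[OF assms(4) c(2)] c(1) assms(3) by blast
  have "span b \<subseteq> U"
    by (rule span_minimal) (use b assms in auto)
  then have "v \<notin> span b"
    using v by blast
  then have "independent (insert v b)"
    using b(2) by (simp add: independent_insert)
  moreover have "insert v b \<subseteq> span c"
    using b c v assms(2) by blast
  ultimately have "finite (insert v b) \<and> card (insert v b) \<le> card c"
    by (rule independent_span_bound[OF finc])
  moreover have "v \<notin> b"
    using b v by blast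
  ultimately show ?thesis
    using b c by auto
qed

lemma flat_subspace: "subspace V \<Longrightarrow> flat scale V"
  unfolding flat_def by (auto intro: subspace_add subspace_scale subspace_diff dest: subspace_0)

text \<open>Closure under \<open>x + s c (y - z)\<close> with three points is what makes differences
  closed under addition. Closure under lines through two points would say nothing over the field
  with two elements.\<close>

lemma subspace_direction:
  assumes "flat scale A"
  shows "subspace {y - z |y z. y \<in> A \<and> z \<in> A}"
proof (rule subspaceI)
  have *: "x + scale c (y - z) \<in> A" if "x \<in> A" "y \<in> A" "z \<in> A" for x y z c
    using assms that unfolding flat_def by blast
  show "0 \<in> {y - z |y z. y \<in> A \<and> z \<in> A}"
    using assms unfolding flat_def by force
  show "u + v \<in> {y - z |y z. y \<in> A \<and> z \<in> A}"
    if u: "u \<in> {y - z |y z. y \<in> A \<and> z \<in> A}" and v: "v \<in> {y - z |y z. y \<in> A \<and> z \<in> A}" for u v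
  proof -
    obtain y z y' z' where "u = y - z" "v = y' - z'" "y \<in> A" "z \<in> A" "y' \<in> A" "z' \<in> A"
      using u v by blast
    then have "u + v = (y + scale 1 (y' - z')) - z" "y + scale 1 (y' - z') \<in> A"
      using *[of y y' z' 1] by auto
    then show ?thesis
      using \<open>z \<in> A\<close> by blast
  qed
  show "scale c u \<in> {y - z |y z. y \<in> A \<and> z \<in> A}"
    if u: "u \<in> {y - z |y z. y \<in> A \<and> z \<in> A}" for c u
  proof -
    obtain y z where "u = y - z" "y \<in> A" "z \<in> A"
      using u by blast
    then have "scale c u = (z + scale c (y - z)) - z" "z + scale c (y - z) \<in> A"
      using *[of z y z c] by auto
    then show ?thesis
      using \<open>z \<in> A\<close> by blast
  qed
qed

text \<open>A member whose direction space has least dimension is minimal: an affine subspace of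
  \<open>A\<close> with the same direction as \<open>A\<close> is all of \<open>A\<close>.\<close>

lemma flat_minimal:
  assumes "\<A> \<noteq> {}" "\<And>A. A \<in> \<A> \<Longrightarrow> flat scale A \<and> A \<subseteq> V"
    and V: "V \<subseteq> span B" "finite B"
  shows "\<exists>A\<in>\<A>. \<forall>A'\<in>\<A>. A' \<subseteq> A \<longrightarrow> A' = A"
proof -
  define dir :: "'b set \<Rightarrow> 'b set" where "dir = (\<lambda>A. {y - z |y z. y \<in> A \<and> z \<in> A})"
  obtain A where A: "A \<in> \<A>" "\<And>A'. A' \<in> \<A> \<Longrightarrow> dim (dir A) \<le> dim (dir A')"
    using assms(1) ex_has_least_nat[of "\<lambda>A. A \<in> \<A>" _ "\<lambda>A. dim (dir A)"] by blast
  have "A' = A" if A': "A' \<in> \<A>" "A' \<subseteq> A" for A'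
  proof (rule ccontr)
    assume "A' \<noteq> A"
    then obtain a where a: "a \<in> A" "a \<notin> A'"
      using A' by blast
    obtain a' where a': "a' \<in> A'"
      using assms(2) A' unfolding flat_def by blast
    have "a - a' \<in> dir A"
      unfolding dir_def using a a' A' by blast
    moreover have "a - a' \<notin> dir A'"
    proof
      assume "a - a' \<in> dir A'"
      then obtain y z where "a - a' = y - z" "y \<in> A'" "z \<in> A'"
        unfolding dir_def by blast
      moreover from this have "a' + scale 1 (y - z) \<in> A'"
        using a' assms(2)[OF A'(1)] unfolding flat_def by blast
      ultimately have "a \<in> A'"
        by (metis add.commute diff_add_cancel scale_one)
      then show False
        using a by simp
    qed
    moreover have "dir A' \<subseteq> dir A"
      unfolding dir_def using A' by blast
    ultimately have "dir A' \<subset> dir A"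
      by blast
    moreover have "dir A \<subseteq> span B"
      unfolding dir_def using assms(2)[OF A(1)] V(1) span_diff by blast
    moreover have "subspace (dir A')"
      unfolding dir_def using assms(2) A' by (auto intro: subspace_direction)
    ultimately have "dim (dir A') < dim (dir A)"
      using V(2) dim_strict_mono by blast
    then show False
      using A(2)[OF A'(1)] by simp
  qed
  then show ?thesis
    using A by blast
qed

end

section \<open>Persistence modules and codirected systems of affine subspaces\<close>

locale pers_mod = vector_space s
  for s :: "'k::field \<Rightarrow> 'v::ab_group_add \<Rightarrow> 'v" +
  fixes M :: "'p::order \<Rightarrow> 'v set" and f :: "'p \<Rightarrow> 'p \<Rightarrow> 'v \<Rightarrow> 'v"
  assumes subspace_M: "subspace (M p)"
    and map_in: "p \<le> q \<Longrightarrow> x \<in> M p \<Longrightarrow> f p q x \<in> M q"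
    and map_add: "p \<le> q \<Longrightarrow> x \<in> M p \<Longrightarrow> y \<in> M p \<Longrightarrow> f p q (x + y) = f p q x + f p q y"
    and map_scale: "p \<le> q \<Longrightarrow> x \<in> M p \<Longrightarrow> f p q (s c x) = s c (f p q x)"
    and map_id: "x \<in> M p \<Longrightarrow> f p p x = x"
    and map_comp: "p \<le> q \<Longrightarrow> q \<le> r \<Longrightarrow> x \<in> M p \<Longrightarrow> f q r (f p q x) = f p r x"
    and pfd: "\<exists>B. finite B \<and> M p \<subseteq> span B"
begin

lemma M_zero [simp]: "0 \<in> M p"
  and M_add: "x \<in> M p \<Longrightarrow> y \<in> M p \<Longrightarrow> x + y \<in> M p"
  and M_scale: "x \<in> M p \<Longrightarrow> s c x \<in> M p"
  and M_diff: "x \<in> M p \<Longrightarrow> y \<in> M p \<Longrightarrow> x - y \<in> M p"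
  using subspace_M[of p]
  by (auto intro: subspace_0 subspace_add subspace_scale subspace_diff)

lemma map_zero [simp]: "p \<le> q \<Longrightarrow> f p q 0 = 0"
  using map_scale[of p q 0 0] by simp

lemma map_diff:
  assumes "p \<le> q" "x \<in> M p" "y \<in> M p"
  shows "f p q (x - y) = f p q x - f p q y"
  using map_add[OF assms(1) M_diff[OF assms(2,3)] assms(3)] by (simp add: algebra_simps)

lemma M_minimal:
  assumes "\<A> \<noteq> {}" "\<And>A. A \<in> \<A> \<Longrightarrow> flat s A \<and> A \<subseteq> M p"
  shows "\<exists>A\<in>\<A>. \<forall>A'\<in>\<A>. A' \<subseteq> A \<longrightarrow> A' = A"
proof -
  obtain B where "finite B" "M p \<subseteq> span B"
    using pfd by blast
  then show ?thesis
    using flat_minimal[OF assms] by blast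
qed

definition submod :: "('p \<Rightarrow> 'v set) \<Rightarrow> bool" where
  "submod C \<longleftrightarrow> (\<forall>p. subspace (C p) \<and> C p \<subseteq> M p) \<and>
     (\<forall>p q. p \<le> q \<longrightarrow> f p q ` C p \<subseteq> C q)"

lemma submodD:
  assumes "submod C"
  shows "subspace (C p)" "x \<in> C p \<Longrightarrow> x \<in> M p" "p \<le> q \<Longrightarrow> x \<in> C p \<Longrightarrow> f p q x \<in> C q"
  using assms unfolding submod_def by blast+

text \<open>Here it pays off that the finite set in the assumption \<open>pfd\<close> of the locale
  may lie outside \<open>M p\<close>: the same set serves for every submodule.\<close>

lemma submod_imp_pers_mod:
  assumes "submod C"
  shows "pers_mod s C f"
proof
  show "\<exists>B. finite B \<and> C p \<subseteq> span B" for p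
    using pfd[of p] submodD(2)[OF assms] by blast
qed (use submodD[OF assms] in \<open>auto intro: map_add map_scale map_id map_comp\<close>)

definition system :: "'p set \<Rightarrow> ('p \<Rightarrow> 'v set) \<Rightarrow> bool" where
  "system Q X \<longleftrightarrow> (\<forall>q\<in>Q. flat s (X q) \<and> X q \<subseteq> M q) \<and>
     (\<forall>q\<in>Q. \<forall>r\<in>Q. q \<le> r \<longrightarrow> f q r ` X q \<subseteq> X r)"

lemma flat_image:
  assumes "flat s A" "A \<subseteq> M p" "p \<le> q"
  shows "flat s (f p q ` A)"
  unfolding flat_def
proof (intro conjI ballI allI)
  show "f p q ` A \<noteq> {}"
    using assms(1) unfolding flat_def by blast
  fix x y z c
  assume "x \<in> f p q ` A" "y \<in> f p q ` A" "z \<in> f p q ` A"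
  then obtain a b d where *: "a \<in> A" "b \<in> A" "d \<in> A" "x = f p q a" "y = f p q b" "z = f p q d"
    by blast
  then have "a \<in> M p" "b \<in> M p" "d \<in> M p"
    using assms by auto
  then have "x + s c (y - z) = f p q (a + s c (b - d))"
    using assms(3) * by (simp add: map_add map_scale map_diff M_scale M_diff)
  moreover have "a + s c (b - d) \<in> A"
    using * assms(1) unfolding flat_def by blast
  ultimately show "x + s c (y - z) \<in> f p q ` A"
    by blast
qed

lemma flat_fibre:
  assumes "flat s A" "A \<subseteq> M p" "p \<le> q" "y \<in> f p q ` A"
  shows "flat s {u \<in> A. f p q u = y}"
  unfolding flat_def
proof (intro conjI ballI allI)
  show "{u \<in> A. f p q u = y} \<noteq> {}"
    using assms(4) by blast
  fix a b d c
  assume *: "a \<in> {u \<in> A. f p q u = y}" "b \<in> {u \<in> A. f p q u = y}" "d \<in> {u \<in> A. f p q u = y}"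
  then have "a \<in> M p" "b \<in> M p" "d \<in> M p"
    using assms by auto
  then have "f p q (a + s c (b - d)) = y"
    using assms(3) * by (simp add: map_add map_scale map_diff M_scale M_diff)
  then show "a + s c (b - d) \<in> {u \<in> A. f p q u = y}"
    using * assms(1) unfolding flat_def by blast
qed

text \<open>The images in \<open>M q\<close> shrink as \<open>t\<close> goes down, and
  codirectedness makes the family of images directed downwards. A minimal image is then the least
  one, so the intersection is a single image, in particular non-empty and affine. The family
  \<open>Z\<close> lives only below \<open>r\<close> so that it may consist of fibres over a point
  at \<open>r\<close>.\<close>

lemma system_stable_image:
  assumes codir: "\<And>q r. q \<in> Q \<Longrightarrow> r \<in> Q \<Longrightarrow> \<exists>t\<in>Q. t \<le> q \<and> t \<le> r"
    and r: "r \<in> Q" and Z: "system {t\<in>Q. t \<le> r} Z"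
  shows "system Q (\<lambda>q. \<Inter>t\<in>{t\<in>Q. t \<le> q \<and> t \<le> r}. f t q ` Z t)"
proof -
  have ZM: "flat s (Z t)" "Z t \<subseteq> M t" if "t \<in> Q" "t \<le> r" for t
    using Z that unfolding system_def by auto
  have Zf: "f t u z \<in> Z u" if "t \<in> Q" "u \<in> Q" "t \<le> u" "u \<le> r" "z \<in> Z t" for t u z
    using Z that order_trans[OF that(3,4)] unfolding system_def by blast
  have im: "\<exists>v\<in>Q. v \<le> q \<and> v \<le> r \<and> f v q ` Z v \<subseteq> f t q ` Z t \<inter> f u q ` Z u"
    if tu: "q \<in> Q" "t \<in> Q" "t \<le> q" "t \<le> r" "u \<in> Q" "u \<le> q" "u \<le> r" for q t u
  proof -
    obtain v where v: "v \<in> Q" "v \<le> t" "v \<le> u"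
      using codir[OF tu(2,5)] by blast
    have "f v q z \<in> f w q ` Z w" if "w \<in> Q" "w \<le> q" "w \<le> r" "v \<le> w" "z \<in> Z v" for z w
    proof -
      have "z \<in> M v"
        using ZM(2)[of v] v that by (meson order_trans subsetD)
      then have "f v q z = f w q (f v w z)"
        using that by (simp add: map_comp)
      then show ?thesis
        using Zf[of v w z] v that by blast
    qed
    then have "f v q ` Z v \<subseteq> f t q ` Z t \<inter> f u q ` Z u"
      using v tu by blast
    then show ?thesis
      using v tu by (meson order_trans)
  qed
  show ?thesis
    unfolding system_def
  proof (intro conjI ballI impI)
    fix q assume q: "q \<in> Q"
    define \<A> where "\<A> = (\<lambda>t. f t q ` Z t) ` {t\<in>Q. t \<le> q \<and> t \<le> r}"
    have "\<A> \<noteq> {}"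
      unfolding \<A>_def using codir[OF q r] by blast
    moreover have fl: "flat s A \<and> A \<subseteq> M q" if "A \<in> \<A>" for A
      using that ZM unfolding \<A>_def by (auto intro!: flat_image map_in)
    ultimately obtain A where A: "A \<in> \<A>" "\<And>A'. A' \<in> \<A> \<Longrightarrow> A' \<subseteq> A \<Longrightarrow> A' = A"
      using M_minimal[of \<A>] by metis
    have im2: "\<exists>A\<in>\<A>. A \<subseteq> A1 \<inter> A2" if A12: "A1 \<in> \<A>" "A2 \<in> \<A>" for A1 A2
    proof -
      obtain t u where tu: "t \<in> Q" "t \<le> q" "t \<le> r" "u \<in> Q" "u \<le> q" "u \<le> r"
        "A1 = f t q ` Z t" "A2 = f u q ` Z u"
        using A12 unfolding \<A>_def by blast
      show ?thesis
        using im[OF q tu(1-6)] unfolding \<A>_def tu(7,8) by blast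
    qed
    have "A \<subseteq> A'" if "A' \<in> \<A>" for A'
    proof -
      obtain A'' where A'': "A'' \<in> \<A>" "A'' \<subseteq> A \<inter> A'"
        using im2[OF A(1)] \<open>A' \<in> \<A>\<close> by metis
      then have "A'' = A"
        by (intro A(2)) auto
      then show ?thesis
        using A'' by simp
    qed
    then have "(\<Inter>t\<in>{t\<in>Q. t \<le> q \<and> t \<le> r}. f t q ` Z t) = A"
      using A(1) unfolding \<A>_def by blast
    then show "flat s (\<Inter>t\<in>{t\<in>Q. t \<le> q \<and> t \<le> r}. f t q ` Z t)"
      "(\<Inter>t\<in>{t\<in>Q. t \<le> q \<and> t \<le> r}. f t q ` Z t) \<subseteq> M q"
      using fl[OF A(1)] by auto
  next
    fix q q' assume q: "q \<in> Q" "q' \<in> Q" "q \<le> q'"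
    show "f q q' ` (\<Inter>t\<in>{t\<in>Q. t \<le> q \<and> t \<le> r}. f t q ` Z t)
      \<subseteq> (\<Inter>t\<in>{t\<in>Q. t \<le> q' \<and> t \<le> r}. f t q' ` Z t)"
    proof (intro subsetI INT_I)
      fix x t assume x: "x \<in> f q q' ` (\<Inter>t\<in>{t\<in>Q. t \<le> q \<and> t \<le> r}. f t q ` Z t)"
        and t: "t \<in> {t\<in>Q. t \<le> q' \<and> t \<le> r}"
      obtain y where y: "x = f q q' y" "y \<in> (\<Inter>t\<in>{t\<in>Q. t \<le> q \<and> t \<le> r}. f t q ` Z t)"
        using x by blast
      \<comment> \<open>An element of the stable image at \<open>q\<close> comes from arbitrarily
        far down, so also from a point below the prescribed \<open>t\<close>; the way up to
        \<open>q'\<close> may then be routed through \<open>t\<close>.\<close>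
      obtain v where v: "v \<in> Q" "v \<le> q" "v \<le> t"
        using codir[of q t] q t by blast
      then have vr: "v \<le> r"
        using t order_trans by blast
      then obtain z where z: "z \<in> Z v" "y = f v q z"
        using y v by blast
      then have "z \<in> M v"
        using ZM v vr by blast
      then have "x = f t q' (f v t z)"
        using y z v t q by (simp add: map_comp)
      then show "x \<in> f t q' ` Z t"
        using Zf[of v t z] v t z by blast
    qed
  qed
qed

text \<open>A minimal subsystem consists of singletons: restricting to the stable images, and then to
  the stable images of the fibres over a point, gives smaller subsystems.\<close>

lemma system_has_section:
  assumes codir: "\<And>q r. q \<in> Q \<Longrightarrow> r \<in> Q \<Longrightarrow> \<exists>t\<in>Q. t \<le> q \<and> t \<le> r"
    and X: "system Q X"
  obtains x where "\<And>q. q \<in> Q \<Longrightarrow> x q \<in> X q"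
    "\<And>q r. q \<in> Q \<Longrightarrow> r \<in> Q \<Longrightarrow> q \<le> r \<Longrightarrow> f q r (x q) = x r"
proof -
  \<comment> \<open>The empty value off \<open>Q\<close> is a normal form: equality and order of
    members of \<open>\<S>\<close> are then decided on \<open>Q\<close>.\<close>
  define \<S> where "\<S> = {Y. system Q Y \<and> (\<forall>q\<in>Q. Y q \<subseteq> X q) \<and> (\<forall>q. q \<notin> Q \<longrightarrow> Y q = {})}"
  define R :: "('p \<Rightarrow> 'v set) \<Rightarrow> ('p \<Rightarrow> 'v set) \<Rightarrow> bool" where "R = (\<lambda>Y Y'. Y' \<le> Y)"
  have "\<exists>Y\<in>\<S>. \<forall>Y'\<in>\<S>. R Y Y' \<longrightarrow> Y' = Y"
  proof (rule predicate_Zorn)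
    show "partial_order_on \<S> (relation_of R \<S>)"
      by (rule partial_order_on_relation_ofI) (auto simp: R_def)
  next
    fix \<C> assume "\<C> \<in> Chains (relation_of R \<S>)"
    then have \<C>: "\<And>Y. Y \<in> \<C> \<Longrightarrow> Y \<in> \<S>" "\<And>Y Y'. Y \<in> \<C> \<Longrightarrow> Y' \<in> \<C> \<Longrightarrow> Y \<le> Y' \<or> Y' \<le> Y"
      unfolding Chains_def relation_of_def R_def by auto
    show "\<exists>U\<in>\<S>. \<forall>Y\<in>\<C>. R Y U"
    proof (cases "\<C> = {}")
      case True
      have "(\<lambda>q. if q \<in> Q then X q else {}) \<in> \<S>"
        using X unfolding \<S>_def system_def by auto
      then show ?thesis
        using True by blast
    next
      case False
      define U where "U = (\<lambda>q. \<Inter>Y\<in>\<C>. Y q)"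
      \<comment> \<open>At each single point the intersection along the chain is attained, which
        keeps it non-empty. The member attaining it may vary with \<open>q\<close>.\<close>
      have U: "\<exists>Y\<in>\<C>. U q = Y q" if "q \<in> Q" for q
      proof -
        have "(\<lambda>Y. Y q) ` \<C> \<noteq> {}" "\<And>A. A \<in> (\<lambda>Y. Y q) ` \<C> \<Longrightarrow> flat s A \<and> A \<subseteq> M q"
          using False \<C>(1) that unfolding \<S>_def system_def by blast+
        then obtain A where A: "A \<in> (\<lambda>Y. Y q) ` \<C>"
            "\<And>A'. A' \<in> (\<lambda>Y. Y q) ` \<C> \<Longrightarrow> A' \<subseteq> A \<Longrightarrow> A' = A"
          using M_minimal[of "(\<lambda>Y. Y q) ` \<C>"] by metis
        then obtain Y where Y: "Y \<in> \<C>" "A = Y q"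
          by blast
        have "Y q \<subseteq> Y' q" if "Y' \<in> \<C>" for Y'
          using \<C>(2)[OF Y(1) that] A(2)[of "Y' q"] Y(2) that by (auto simp: le_fun_def)
        then have "U q = Y q"
          unfolding U_def using Y(1) by blast
        then show ?thesis
          using Y(1) by blast
      qed
      have "system Q U"
        unfolding system_def
      proof (intro conjI ballI impI)
        fix q assume q: "q \<in> Q"
        obtain Y where "Y \<in> \<C>" "U q = Y q"
          using U[OF q] by blast
        then show "flat s (U q)" "U q \<subseteq> M q"
          using \<C>(1)[of Y] q unfolding \<S>_def system_def by auto
      next
        fix q r assume q: "q \<in> Q" "r \<in> Q" "q \<le> r"
        have "f q r x \<in> Y r" if "x \<in> U q" "Y \<in> \<C>" for x Y
          using that \<C>(1)[of Y] q unfolding \<S>_def system_def U_def by blast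
        then show "f q r ` U q \<subseteq> U r"
          unfolding U_def by blast
      qed
      moreover have "\<forall>q\<in>Q. U q \<subseteq> X q" "\<forall>q. q \<notin> Q \<longrightarrow> U q = {}"
        using False \<C>(1) unfolding U_def \<S>_def by blast+
      ultimately have "U \<in> \<S>"
        unfolding \<S>_def by blast
      moreover have "R Y U" if "Y \<in> \<C>" for Y
        using that unfolding R_def U_def le_fun_def by blast
      ultimately show ?thesis
        by blast
    qed
  qed
  then obtain Y where Y: "Y \<in> \<S>" and min: "\<And>Y'. Y' \<in> \<S> \<Longrightarrow> Y' \<le> Y \<Longrightarrow> Y' = Y"
    unfolding R_def by blast
  have sysY: "system Q Y" and YX: "\<And>q. q \<in> Q \<Longrightarrow> Y q \<subseteq> X q" and YQ: "\<And>q. q \<notin> Q \<Longrightarrow> Y q = {}"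
    using Y unfolding \<S>_def by auto
  \<comment> \<open>The stable images of \<open>Z\<close> form a system inside \<open>Y\<close>, so
    by minimality they are \<open>Y\<close> itself. Taking \<open>Z = Y\<close> gives surjectivity,
    and taking fibres over \<open>y\<close> collapses \<open>Y r\<close> to
    \<open>{y}\<close>.\<close>
  have stable: "Y q \<subseteq> f t q ` Z t"
    if r: "r \<in> Q" and Z: "system {t\<in>Q. t \<le> r} Z" "\<And>t. t \<in> Q \<Longrightarrow> t \<le> r \<Longrightarrow> Z t \<subseteq> Y t"
      and q: "q \<in> Q" "t \<in> Q" "t \<le> q" "t \<le> r" for r Z q t
  proof -
    define Y' where "Y' = (\<lambda>q. if q \<in> Q then (\<Inter>t\<in>{t\<in>Q. t \<le> q \<and> t \<le> r}. f t q ` Z t) else {})"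
    have sub: "Y' q \<subseteq> Y q" for q
    proof (cases "q \<in> Q")
      case True
      obtain t where t: "t \<in> Q" "t \<le> q" "t \<le> r"
        using codir[OF True r] by blast
      have "f t q ` Z t \<subseteq> Y q"
        using sysY t True Z(2) unfolding system_def by blast
      then show ?thesis
        unfolding Y'_def using t by auto
    qed (simp add: Y'_def)
    have "system Q Y'"
      using system_stable_image[OF codir r Z(1)] unfolding system_def Y'_def by auto
    then have "Y' \<in> \<S>"
      using sub YX YQ unfolding \<S>_def Y'_def by blast
    then have "Y' = Y"
      using min sub by (simp add: le_fun_def)
    then have "Y q = (\<Inter>t\<in>{t\<in>Q. t \<le> q \<and> t \<le> r}. f t q ` Z t)"
      using q(1) unfolding Y'_def by auto
    then show ?thesis
      using q by auto
  qed
  have surj: "Y r \<subseteq> f t r ` Y t" if "t \<in> Q" "r \<in> Q" "t \<le> r" for t r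
    by (rule stable[of r Y r t]) (use that sysY in \<open>auto simp: system_def\<close>)
  have single: "Y r = {y}" if r: "r \<in> Q" and y: "y \<in> Y r" for r y
  proof -
    define Z where "Z = (\<lambda>t. {u \<in> Y t. f t r u = y})"
    have "system {t\<in>Q. t \<le> r} Z"
      unfolding system_def
    proof (intro conjI ballI impI)
      fix t assume t: "t \<in> {t\<in>Q. t \<le> r}"
      then have "flat s (Y t)" "Y t \<subseteq> M t" "t \<le> r" "y \<in> f t r ` Y t"
        using surj[of t r] y sysY r unfolding system_def by blast+
      then show "flat s (Z t)"
        unfolding Z_def by (rule flat_fibre)
      show "Z t \<subseteq> M t"
        using t sysY unfolding Z_def system_def by auto
    next
      fix t u assume tu: "t \<in> {t\<in>Q. t \<le> r}" "u \<in> {t\<in>Q. t \<le> r}" "t \<le> u"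
      show "f t u ` Z t \<subseteq> Z u"
      proof
        fix x assume "x \<in> f t u ` Z t"
        then obtain z where z: "x = f t u z" "z \<in> Y t" "f t r z = y"
          unfolding Z_def by blast
        moreover have "z \<in> M t"
          using sysY z tu unfolding system_def by auto
        ultimately have "f u r x = y"
          using tu by (simp add: map_comp)
        moreover have "x \<in> Y u"
          using sysY z tu unfolding system_def by blast
        ultimately show "x \<in> Z u"
          unfolding Z_def by blast
      qed
    qed
    then have "Y r \<subseteq> f r r ` Z r"
      by (rule stable[OF r]) (use r in \<open>auto simp: Z_def\<close>)
    also have "\<dots> \<subseteq> {y}"
      unfolding Z_def by auto
    finally show ?thesis
      using y by blast
  qed
  have "\<exists>y. Y q = {y}" if "q \<in> Q" for q
  proof -
    have "Y q \<noteq> {}"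
      using sysY that unfolding system_def flat_def by blast
    then show ?thesis
      using single[OF that] by blast
  qed
  then obtain x where x: "\<And>q. q \<in> Q \<Longrightarrow> Y q = {x q}"
    by metis
  show ?thesis
  proof (rule that)
    show "x q \<in> X q" if "q \<in> Q" for q
      using x YX that by blast
    show "f q r (x q) = x r" if "q \<in> Q" "r \<in> Q" "q \<le> r" for q r
      using sysY x that unfolding system_def by blast
  qed
qed

end

section \<open>Splitting off a generator\<close>

context pers_mod
begin

text \<open>A generator with support \<open>B\<close> spans a copy of the module \<open>k\<^sub>B\<close>: being zero off \<open>B\<close>, it is also
  required to die on leaving \<open>B\<close>.\<close>

definition generator :: "('p \<Rightarrow> 'v) \<Rightarrow> bool" where
  "generator z \<longleftrightarrow> (\<forall>q. z q \<in> M q) \<and> (\<forall>q r. z q \<noteq> 0 \<longrightarrow> q \<le> r \<longrightarrow> f q r (z q) = z r)"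

text \<open>Where \<open>z\<close> vanishes, the last clause forces \<open>C q = M q\<close>;
  elsewhere \<open>C q\<close> is a complement of the line through \<open>z q\<close>. So
  \<open>M\<close> is the direct sum of \<open>C\<close> and the copy of the block module generated
  by \<open>z\<close>.\<close>

definition splits :: "('p \<Rightarrow> 'v) \<Rightarrow> ('p \<Rightarrow> 'v set) \<Rightarrow> bool" where
  "splits z C \<longleftrightarrow> generator z \<and> submod C \<and> (\<forall>q. z q \<noteq> 0 \<longrightarrow> z q \<notin> C q) \<and>
     (\<forall>q. \<forall>m\<in>M q. \<exists>c. m - s c (z q) \<in> C q)"

lemma submod_adjoin:
  assumes C: "submod C" and m: "m \<in> M q"
  shows "submod (\<lambda>r. if q \<le> r then {c + s a (f q r m) |c a. c \<in> C r} else C r)"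
    (is "submod ?E")
  unfolding submod_def
proof (intro conjI allI impI)
  note CD = submodD[OF C]
  fix r
  show "subspace (?E r)"
  proof (cases "q \<le> r")
    case True
    have "subspace {c + s a (f q r m) |c a. c \<in> C r}"
    proof (rule subspaceI)
      show "0 \<in> {c + s a (f q r m) |c a. c \<in> C r}"
        using subspace_0[OF CD(1)] by (auto intro!: exI[of _ 0])
    next
      fix x y
      assume "x \<in> {c + s a (f q r m) |c a. c \<in> C r}" "y \<in> {c + s a (f q r m) |c a. c \<in> C r}"
      then obtain c a d b where "x = c + s a (f q r m)" "y = d + s b (f q r m)" "c \<in> C r" "d \<in> C r"
        by blast
      then have "x + y = (c + d) + s (a + b) (f q r m)" "c + d \<in> C r"
        by (auto simp: scale_left_distrib algebra_simps intro: subspace_add CD(1))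
      then show "x + y \<in> {c + s a (f q r m) |c a. c \<in> C r}"
        by blast
    next
      fix x e
      assume "x \<in> {c + s a (f q r m) |c a. c \<in> C r}"
      then obtain c a where "x = c + s a (f q r m)" "c \<in> C r"
        by blast
      then have "s e x = s e c + s (e * a) (f q r m)" "s e c \<in> C r"
        by (auto simp: scale_right_distrib intro: subspace_scale CD(1))
      then show "s e x \<in> {c + s a (f q r m) |c a. c \<in> C r}"
        by blast
    qed
    then show ?thesis
      using True by simp
  qed (simp add: CD(1))
  show "?E r \<subseteq> M r"
    using CD(2) m by (auto intro!: M_add M_scale map_in)
next
  note CD = submodD[OF C]
  fix r t :: 'p assume rt: "r \<le> t"
  show "f r t ` ?E r \<subseteq> ?E t"
  proof
    fix y assume "y \<in> f r t ` ?E r"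
    then obtain x where x: "y = f r t x" "x \<in> ?E r"
      by blast
    show "y \<in> ?E t"
    proof (cases "q \<le> r")
      case True
      then obtain c a where ca: "x = c + s a (f q r m)" "c \<in> C r"
        using x by auto
      have "y = f r t c + s a (f q t m)"
        using x ca CD(2) True rt m by (simp add: map_add map_scale M_scale map_in map_comp)
      moreover have "f r t c \<in> C t"
        using CD(3) rt ca by blast
      ultimately show ?thesis
        using order_trans[OF True rt] by auto
    next
      case False
      then have "y \<in> C t"
        using x CD(3) rt by auto
      moreover have "y = y + s 0 (f q t m)"
        by simp
      ultimately show ?thesis
        by (simp only: if_split mem_Collect_eq) blast
    qed
  qed
qed

lemma submod_Union_chain:
  assumes "\<C> \<noteq> {}" "\<And>C. C \<in> \<C> \<Longrightarrow> submod C"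
    "\<And>C D. C \<in> \<C> \<Longrightarrow> D \<in> \<C> \<Longrightarrow> C \<le> D \<or> D \<le> C"
  shows "submod (\<lambda>q. \<Union>C\<in>\<C>. C q)"
  unfolding submod_def
proof (intro conjI allI impI)
  fix q
  show "subspace (\<Union>C\<in>\<C>. C q)"
  proof (rule subspaceI)
    show "0 \<in> (\<Union>C\<in>\<C>. C q)"
      using assms(1) submodD(1)[OF assms(2)] subspace_0 by blast
  next
    fix x y assume "x \<in> (\<Union>C\<in>\<C>. C q)" "y \<in> (\<Union>C\<in>\<C>. C q)"
    then obtain C D where CD: "C \<in> \<C>" "D \<in> \<C>" "x \<in> C q" "y \<in> D q"
      by blast
    then obtain E where "E \<in> \<C>" "x \<in> E q" "y \<in> E q"
      using assms(3)[OF CD(1,2)] unfolding le_fun_def by blast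
    then show "x + y \<in> (\<Union>C\<in>\<C>. C q)"
      using submodD(1)[OF assms(2)] subspace_add by blast
  next
    fix x c assume "x \<in> (\<Union>C\<in>\<C>. C q)"
    then show "s c x \<in> (\<Union>C\<in>\<C>. C q)"
      using submodD(1)[OF assms(2)] subspace_scale by blast
  qed
  show "(\<Union>C\<in>\<C>. C q) \<subseteq> M q"
    using submodD(2)[OF assms(2)] by blast
next
  fix q r :: 'p assume "q \<le> r"
  then show "f q r ` (\<Union>C\<in>\<C>. C q) \<subseteq> (\<Union>C\<in>\<C>. C r)"
    using submodD(3)[OF assms(2)] by blast
qed

text \<open>The complement is a submodule maximal among those avoiding the generator. If it were too small
  at \<open>q\<close>, adjoining some \<open>m\<close> would produce the generator at some later point, which determines its
  coefficient, and then adjoining a suitable \<open>m - \<mu> z q\<close> would not.\<close>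

lemma generator_splits:
  assumes z: "generator z" and D: "submod D"
    and off: "\<And>q. z q = 0 \<Longrightarrow> M q \<subseteq> D q" and on: "\<And>q. z q \<noteq> 0 \<Longrightarrow> z q \<notin> D q"
    and dir: "\<And>q r. z q \<noteq> 0 \<Longrightarrow> z r \<noteq> 0 \<Longrightarrow> \<exists>t. q \<le> t \<and> r \<le> t \<and> z t \<noteq> 0"
  obtains C where "splits z C"
proof -
  have zM: "z q \<in> M q" and zf: "z q \<noteq> 0 \<Longrightarrow> q \<le> r \<Longrightarrow> f q r (z q) = z r" for q r
    using z unfolding generator_def by auto
  define \<S> where "\<S> = {C. submod C \<and> D \<le> C \<and> (\<forall>q. z q \<noteq> 0 \<longrightarrow> z q \<notin> C q)}"
  have "\<exists>C\<in>\<S>. \<forall>C'\<in>\<S>. C \<le> C' \<longrightarrow> C' = C"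
  proof (rule predicate_Zorn)
    show "partial_order_on \<S> (relation_of (\<le>) \<S>)"
      by (rule partial_order_on_relation_ofI) auto
  next
    fix \<C> assume "\<C> \<in> Chains (relation_of (\<le>) \<S>)"
    then have \<C>: "\<And>C. C \<in> \<C> \<Longrightarrow> C \<in> \<S>" "\<And>C C'. C \<in> \<C> \<Longrightarrow> C' \<in> \<C> \<Longrightarrow> C \<le> C' \<or> C' \<le> C"
      unfolding Chains_def relation_of_def by auto
    show "\<exists>U\<in>\<S>. \<forall>C\<in>\<C>. C \<le> U"
    proof (cases "\<C> = {}")
      case True
      have "D \<in> \<S>"
        using D on unfolding \<S>_def by auto
      then show ?thesis
        using True by blast
    next
      case False
      have "submod (\<lambda>q. \<Union>C\<in>\<C>. C q)"
        by (rule submod_Union_chain) (use False \<C> in \<open>auto simp: \<S>_def\<close>)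
      moreover have "D \<le> (\<lambda>q. \<Union>C\<in>\<C>. C q)"
        using False \<C>(1) unfolding \<S>_def le_fun_def by blast
      moreover have "\<forall>q. z q \<noteq> 0 \<longrightarrow> z q \<notin> (\<Union>C\<in>\<C>. C q)"
        using \<C>(1) unfolding \<S>_def by blast
      ultimately have "(\<lambda>q. \<Union>C\<in>\<C>. C q) \<in> \<S>"
        unfolding \<S>_def by blast
      then show ?thesis
        by (rule bexI[rotated]) (auto simp: le_fun_def)
    qed
  qed
  then obtain C where C: "C \<in> \<S>" and max: "\<And>C'. C' \<in> \<S> \<Longrightarrow> C \<le> C' \<Longrightarrow> C' = C"
    by blast
  have sC: "submod C" and DC: "D \<le> C" and zC: "\<And>q. z q \<noteq> 0 \<Longrightarrow> z q \<notin> C q"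
    using C unfolding \<S>_def by auto
  note CD = submodD[OF sC]
  \<comment> \<open>By maximality the submodule generated by \<open>C\<close> and \<open>m\<close>
    contains the generator at some point. That point lies above \<open>q\<close>, as nothing was
    added elsewhere.\<close>
  have adj: "\<exists>r c a. q \<le> r \<and> z r \<noteq> 0 \<and> c \<in> C r \<and> z r = c + s a (f q r m)"
    if m: "m \<in> M q" "m \<notin> C q" for m q
  proof (rule ccontr)
    assume neg: "\<not> ?thesis"
    define E where "E = (\<lambda>r. if q \<le> r then {c + s a (f q r m) |c a. c \<in> C r} else C r)"
    have "C \<le> E"
    proof (rule le_funI, rule subsetI)
      fix r x assume "x \<in> C r"
      moreover have "x = x + s 0 (f q r m)"
        by simp
      ultimately show "x \<in> E r"
        unfolding E_def by (simp only: if_split mem_Collect_eq) blast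
    qed
    moreover have "submod E"
      unfolding E_def by (rule submod_adjoin[OF sC m(1)])
    moreover have "z r \<notin> E r" if "z r \<noteq> 0" for r
    proof (cases "q \<le> r")
      case True
      then show ?thesis
        using neg that unfolding E_def by (simp only: if_True mem_Collect_eq) blast
    qed (use zC[OF that] in \<open>simp add: E_def\<close>)
    ultimately have "E \<in> \<S>"
      using DC unfolding \<S>_def by auto
    then have "E = C"
      using max \<open>C \<le> E\<close> by blast
    moreover have "0 + s 1 (f q q m) \<in> E q"
      using subspace_0[OF CD(1), of q]
      unfolding E_def by (simp only: order_refl if_True mem_Collect_eq) blast
    ultimately show False
      using m by (simp add: map_id)
  qed
  have "\<exists>c. m - s c (z q) \<in> C q" if m: "m \<in> M q" for q m
  proof (rule ccontr)
    assume "\<not> ?thesis"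
    then have neg: "m - s c (z q) \<notin> C q" for c
      by blast
    then have mC: "m \<notin> C q"
      using neg[of 0] by simp
    have zq: "z q \<noteq> 0"
      using off DC mC m unfolding le_fun_def by blast
    obtain r c a where r: "q \<le> r" "z r \<noteq> 0" "c \<in> C r" "z r = c + s a (f q r m)"
      using adj[OF m mC] by blast
    have a: "a \<noteq> 0"
      using r zC by auto
    \<comment> \<open>The factor \<open>1 / a\<close> is chosen to cancel the generator at
      \<open>r\<close>: since \<open>z r = c + s a (f q r m)\<close>, the image of \<open>m'\<close>
      there is a multiple of \<open>c\<close> and lies in \<open>C r\<close>.\<close>
    define m' where "m' = m - s (1 / a) (z q)"
    have m': "m' \<in> M q" "m' \<notin> C q"
      using m zM neg unfolding m'_def by (auto intro: M_diff M_scale)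
    have "f q r m' = f q r m - s (1 / a) (z r)"
      unfolding m'_def using m zM zf[OF zq] r by (simp add: map_diff M_scale map_scale)
    also have "\<dots> = s (- (1 / a)) c"
      using a unfolding r(4) by (simp add: scale_right_distrib)
    finally have fm': "f q r m' \<in> C r"
      using r CD(1) by (metis subspace_scale)
    obtain r' c' a' where r': "q \<le> r'" "z r' \<noteq> 0" "c' \<in> C r'" "z r' = c' + s a' (f q r' m')"
      using adj[OF m'] by blast
    \<comment> \<open>At a common later point of the support the two outcomes collide: the image of
      \<open>m'\<close> has already entered \<open>C\<close> at \<open>r\<close>, yet through
      \<open>r'\<close> it would have to account for \<open>z t\<close> modulo
      \<open>C\<close>.\<close>
    obtain t where t: "r \<le> t" "r' \<le> t" "z t \<noteq> 0"
      using dir r r' by blast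
    have "z t = f r' t (z r')"
      using zf[OF r'(2) t(2)] by simp
    also have "\<dots> = f r' t c' + s a' (f q t m')"
      unfolding r'(4) using CD(2)[OF r'(3)] r'(1) t(2) m'(1)
      by (simp add: map_add map_scale map_in M_scale map_comp)
    also have "f q t m' = f r t (f q r m')"
      using r(1) t(1) m'(1) by (simp add: map_comp)
    finally have "z t \<in> C t"
      using CD(3)[OF t(2) r'(3)] CD(3)[OF t(1) fm'] CD(1)
      by (simp add: subspace_add subspace_scale)
    then show False
      using zC t by blast
  qed
  then have "splits z C"
    using z sC zC unfolding splits_def by blast
  then show ?thesis
    by (rule that)
qed

section \<open>Submodules of images, sums and kernels\<close>

definition imgs :: "'p set \<Rightarrow> 'p \<Rightarrow> 'v set" where
  "imgs K q = insert 0 (\<Union>r\<in>{r\<in>K. r \<le> q}. f r q ` M r)"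

text \<open>When \<open>K\<close> has binary joins, two elements arriving at \<open>q\<close> from
  \<open>K\<close> both arrive from the join of their sources, so the union of the images is already
  closed under addition. The zero inserted in \<open>imgs\<close> covers points with nothing of
  \<open>K\<close> below them.\<close>

lemma submod_imgs:
  assumes K: "\<And>r r'. r \<in> K \<Longrightarrow> r' \<in> K \<Longrightarrow>
    \<exists>t\<in>K. r \<le> t \<and> r' \<le> t \<and> (\<forall>q. r \<le> q \<longrightarrow> r' \<le> q \<longrightarrow> t \<le> q)"
  shows "submod (imgs K)"
  unfolding submod_def
proof (intro conjI allI impI)
  fix q
  show "subspace (imgs K q)"
  proof (rule subspaceI)
    show "0 \<in> imgs K q"
      unfolding imgs_def by blast
  next
    fix x y assume xy: "x \<in> imgs K q" "y \<in> imgs K q"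
    show "x + y \<in> imgs K q"
    proof (cases "x = 0 \<or> y = 0")
      case True
      then show ?thesis
        using xy by auto
    next
      case False
      then obtain r a r' b where *: "r \<in> K" "r \<le> q" "a \<in> M r" "x = f r q a"
        "r' \<in> K" "r' \<le> q" "b \<in> M r'" "y = f r' q b"
        using xy unfolding imgs_def by auto
      then obtain t where t: "t \<in> K" "r \<le> t" "r' \<le> t" "t \<le> q"
        using K by meson
      then have "x + y = f t q (f r t a + f r' t b)" "f r t a + f r' t b \<in> M t"
        using * by (auto simp: map_add map_comp map_in M_add)
      then show ?thesis
        using t unfolding imgs_def by blast
    qed
  next
    fix x c assume x: "x \<in> imgs K q"
    show "s c x \<in> imgs K q"
    proof (cases "x = 0")
      case True
      then show ?thesis
        using x by auto
    next
      case False
      then obtain r a where *: "r \<in> K" "r \<le> q" "a \<in> M r" "x = f r q a"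
        using x unfolding imgs_def by auto
      then have "s c x = f r q (s c a)" "s c a \<in> M r"
        by (auto simp: map_scale M_scale)
      then show ?thesis
        using * unfolding imgs_def by blast
    qed
  qed
  show "imgs K q \<subseteq> M q"
    unfolding imgs_def by (auto intro: map_in)
next
  fix q r :: 'p assume qr: "q \<le> r"
  show "f q r ` imgs K q \<subseteq> imgs K r"
  proof
    fix y assume "y \<in> f q r ` imgs K q"
    then obtain x where x: "y = f q r x" "x \<in> imgs K q"
      by blast
    show "y \<in> imgs K r"
    proof (cases "x = 0")
      case True
      then show ?thesis
        using x qr unfolding imgs_def by simp
    next
      case False
      then obtain t a where *: "t \<in> K" "t \<le> q" "a \<in> M t" "x = f t q a"
        using x unfolding imgs_def by auto
      then have "y = f t r a" "t \<le> r"
        using x qr by (auto simp: map_comp)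
      then show ?thesis
        using * unfolding imgs_def by blast
    qed
  qed
qed

lemma imgs_eq: "q \<in> K \<Longrightarrow> M q \<subseteq> imgs K q"
  unfolding imgs_def using map_id[of _ q] by force

lemma submod_sum:
  assumes "submod C" "submod D"
  shows "submod (\<lambda>q. {c + d |c d. c \<in> C q \<and> d \<in> D q})"
  unfolding submod_def
proof (intro conjI allI impI)
  note CD = submodD[OF assms(1)] submodD[OF assms(2)]
  fix q
  show "subspace {c + d |c d. c \<in> C q \<and> d \<in> D q}"
    by (rule subspace_sums) (use CD in auto)
  show "{c + d |c d. c \<in> C q \<and> d \<in> D q} \<subseteq> M q"
    using CD by (auto intro!: M_add)
next
  note CD = submodD[OF assms(1)] submodD[OF assms(2)]
  fix q r :: 'p assume qr: "q \<le> r"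
  have "f q r (c + d) = f q r c + f q r d \<and> f q r c \<in> C r \<and> f q r d \<in> D r"
    if "c \<in> C q" "d \<in> D q" for c d
    using that CD qr by (auto intro: map_add)
  then show "f q r ` {c + d |c d. c \<in> C q \<and> d \<in> D q} \<subseteq> {c + d |c d. c \<in> C r \<and> d \<in> D r}"
    by blast
qed

definition ker :: "'p \<Rightarrow> 'p \<Rightarrow> 'v set" where
  "ker q r = {w \<in> M q. f q r w = 0}"

lemma subspace_ker: "q \<le> r \<Longrightarrow> subspace (ker q r)"
  unfolding ker_def by (rule subspaceI) (auto simp: M_add M_scale map_add map_scale)

lemma ker_mono: "q \<le> r \<Longrightarrow> r \<le> t \<Longrightarrow> ker q r \<subseteq> ker q t"
  unfolding ker_def using map_comp[of q r t] by force

lemma subspace_image_map: "q \<le> r \<Longrightarrow> subspace (f q r ` M q)"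
proof (rule subspaceI)
  assume qr: "q \<le> r"
  show "0 \<in> f q r ` M q"
    using qr by (auto intro!: rev_image_eqI[of 0])
  show "x + y \<in> f q r ` M q" if "x \<in> f q r ` M q" "y \<in> f q r ` M q" for x y
    using that qr by (auto simp flip: map_add intro!: imageI M_add)
  show "s c x \<in> f q r ` M q" if "x \<in> f q r ` M q" for c x
    using that qr by (auto simp flip: map_scale intro!: imageI M_scale)
qed

lemma subspace_minimal:
  assumes "\<A> \<noteq> {}" "\<And>A. A \<in> \<A> \<Longrightarrow> subspace A \<and> A \<subseteq> M p"
  shows "\<exists>A\<in>\<A>. \<forall>A'\<in>\<A>. A' \<subseteq> A \<longrightarrow> A' = A"
proof (rule M_minimal[OF assms(1)])
  show "flat s A \<and> A \<subseteq> M p" if "A \<in> \<A>" for A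
    using assms(2)[OF that] flat_subspace by simp
qed

end

section \<open>Blocks in middle exact modules\<close>

text \<open>Middle exactness in the form of a weak pullback: compatible elements at two opposite
  corners of a rectangle have a common lift, with no claim of uniqueness.\<close>

locale middle_exact_mod = pers_mod s M f
  for s :: "'k::field \<Rightarrow> 'v::ab_group_add \<Rightarrow> 'v"
    and M :: "'s::linorder \<times> 't::linorder \<Rightarrow> 'v set"
    and f :: "'s \<times> 't \<Rightarrow> 's \<times> 't \<Rightarrow> 'v \<Rightarrow> 'v" +
  assumes exact: "\<lbrakk>x \<le> x'; y \<le> y'; u \<in> M (x, y'); v \<in> M (x', y);
      f (x, y') (x', y') u = f (x', y) (x', y') v\<rbrakk>
    \<Longrightarrow> \<exists>w\<in>M (x, y). f (x, y) (x, y') w = u \<and> f (x, y) (x', y) w = v"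
begin

text \<open>The set \<open>A\<close> can be arbitrary, because in a total order the maximum of two
  of its elements is one of them.\<close>

lemma submod_imgs_left: "submod (imgs (A \<times> UNIV))"
proof (rule submod_imgs)
  fix r r' :: "'s \<times> 't" assume "r \<in> A \<times> UNIV" "r' \<in> A \<times> UNIV"
  then have "(max (fst r) (fst r'), max (snd r) (snd r')) \<in> A \<times> UNIV"
    by (auto simp: max_def)
  then show "\<exists>t\<in>A \<times> UNIV. r \<le> t \<and> r' \<le> t \<and> (\<forall>q. r \<le> q \<longrightarrow> r' \<le> q \<longrightarrow> t \<le> q)"
    by (rule bexI[rotated]) (auto simp: less_eq_prod_def)
qed

lemma submod_imgs_below: "submod (imgs (UNIV \<times> A))"
proof (rule submod_imgs)
  fix r r' :: "'s \<times> 't" assume "r \<in> UNIV \<times> A" "r' \<in> UNIV \<times> A"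
  then have "(max (fst r) (fst r'), max (snd r) (snd r')) \<in> UNIV \<times> A"
    by (auto simp: max_def)
  then show "\<exists>t\<in>UNIV \<times> A. r \<le> t \<and> r' \<le> t \<and> (\<forall>q. r \<le> q \<longrightarrow> r' \<le> q \<longrightarrow> t \<le> q)"
    by (rule bexI[rotated]) (auto simp: less_eq_prod_def)
qed

text \<open>The hypotheses concern only points below \<open>p\<close> and points above
  \<open>p\<close>. The remaining points of the rectangle are reached through meets with
  \<open>p\<close>, where the generator is defined by transport, and through joins with
  \<open>p\<close>, where avoidance is tested.\<close>

lemma rectangle_splits:
  assumes p: "p \<in> JS \<times> JT" and z: "z \<in> M p"
    and lift: "\<And>q. q \<in> JS \<times> JT \<Longrightarrow> q \<le> p \<Longrightarrow>
      \<exists>w\<in>M q. f q p w = z \<and> (\<forall>r. q \<le> r \<longrightarrow> r \<notin> JS \<times> JT \<longrightarrow> f q r w = 0)"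
    and avoid: "\<And>q u v. q \<in> JS \<times> JT \<Longrightarrow> p \<le> q \<Longrightarrow> u \<in> imgs ((- JS) \<times> UNIV) q \<Longrightarrow>
      v \<in> imgs (UNIV \<times> (- JT)) q \<Longrightarrow> f p q z \<noteq> u + v"
  obtains \<zeta> C where "splits \<zeta> C" "{q. \<zeta> q \<noteq> 0} = JS \<times> JT"
proof -
  define B where "B = JS \<times> JT"
  have min_B: "(min (fst q) (fst r), min (snd q) (snd r)) \<in> B"
    and max_B: "(max (fst q) (fst r), max (snd q) (snd r)) \<in> B" if "q \<in> B" "r \<in> B" for q r
    using that unfolding B_def by (auto simp: min_def max_def)
  define Q where "Q = {q \<in> B. q \<le> p}"
  define X where "X = (\<lambda>q. {w \<in> M q. f q p w = z \<and> (\<forall>r. q \<le> r \<longrightarrow> r \<notin> B \<longrightarrow> f q r w = 0)})"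
  have pQ: "p \<in> Q"
    using p unfolding Q_def B_def by simp
  have sys: "system Q X"
    unfolding system_def
  proof (intro conjI ballI impI)
    fix q assume q: "q \<in> Q"
    have "X q \<noteq> {}"
      using lift[of q] q unfolding Q_def X_def B_def by blast
    moreover have "a + s c (b - d) \<in> X q" if "a \<in> X q" "b \<in> X q" "d \<in> X q" for a b c d
    proof -
      have "a \<in> M q" "b \<in> M q" "d \<in> M q" "q \<le> p"
        using that q unfolding X_def Q_def by auto
      then show ?thesis
        using that unfolding X_def
        by (auto simp: map_add map_scale map_diff M_add M_scale M_diff)
    qed
    ultimately show "flat s (X q)"
      unfolding flat_def by blast
    show "X q \<subseteq> M q"
      unfolding X_def by blast
  next
    fix q r assume q: "q \<in> Q" "r \<in> Q" "q \<le> r"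
    show "f q r ` X q \<subseteq> X r"
    proof
      fix y assume "y \<in> f q r ` X q"
      then obtain w where w: "w \<in> M q" "f q p w = z" "\<And>t. q \<le> t \<Longrightarrow> t \<notin> B \<Longrightarrow> f q t w = 0" "y = f q r w"
        unfolding X_def by auto
      moreover have "f r t y = 0" if "r \<le> t" "t \<notin> B" for t
        using w that q(3) order_trans[OF q(3) that(1)] by (simp add: map_comp)
      ultimately show "y \<in> X r"
        using q unfolding X_def Q_def by (simp add: map_comp map_in)
    qed
  qed
  have codir: "\<exists>t\<in>Q. t \<le> q \<and> t \<le> r" if "q \<in> Q" "r \<in> Q" for q r
  proof -
    have "(min (fst q) (fst r), min (snd q) (snd r)) \<in> Q"
      using that min_B[of q r] unfolding Q_def by (auto simp: less_eq_prod_def min.coboundedI1)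
    then show ?thesis
      by (rule bexI[rotated]) (auto simp: less_eq_prod_def)
  qed
  obtain x where x: "\<And>q. q \<in> Q \<Longrightarrow> x q \<in> X q"
    and xf: "\<And>q r. q \<in> Q \<Longrightarrow> r \<in> Q \<Longrightarrow> q \<le> r \<Longrightarrow> f q r (x q) = x r"
    using system_has_section[OF codir sys] by blast
  \<comment> \<open>The section \<open>x\<close> exists below \<open>p\<close> only; the generator
    at \<open>q\<close> is transported from the meet of \<open>q\<close> and \<open>p\<close>. Meets
    are monotone in \<open>q\<close>, which makes these values compatible.\<close>
  define m where "m = (\<lambda>q. (min (fst q) (fst p), min (snd q) (snd p)))"
  define \<zeta> where "\<zeta> = (\<lambda>q. if q \<in> B then f (m q) q (x (m q)) else 0)"
  have mQ: "m q \<in> Q" and mq: "m q \<le> q" if "q \<in> B" for q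
    using that p min_B[of q p] unfolding Q_def m_def B_def[symmetric]
    by (auto simp: less_eq_prod_def)
  have xm: "x (m q) \<in> M (m q)" if "q \<in> B" for q
    using x[OF mQ[OF that]] unfolding X_def by blast
  have \<zeta>M: "\<zeta> q \<in> M q" for q
    unfolding \<zeta>_def using map_in[OF mq xm] by simp
  have \<zeta>f: "f q r (\<zeta> q) = \<zeta> r" if q: "q \<in> B" "q \<le> r" for q r
  proof (cases "r \<in> B")
    case True
    have "m q \<le> m r"
      using q(2) unfolding m_def by (auto simp: less_eq_prod_def min.coboundedI1)
    moreover have "\<zeta> r = f (m r) r (f (m q) (m r) (x (m q)))"
      unfolding \<zeta>_def using True xf[OF mQ[OF q(1)] mQ[OF True] \<open>m q \<le> m r\<close>] by simp
    ultimately show ?thesis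
      using True q xm[OF q(1)] mq[OF q(1)] mq[OF True] unfolding \<zeta>_def by (simp add: map_comp)
  next
    case False
    have "f (m q) r (x (m q)) = 0"
      using x[OF mQ[OF q(1)]] False order_trans[OF mq[OF q(1)] q(2)] unfolding X_def by blast
    then show ?thesis
      using False q xm[OF q(1)] mq[OF q(1)] unfolding \<zeta>_def by (simp add: map_comp)
  qed
  have \<zeta>p: "\<zeta> p = z"
  proof -
    have "m p = p"
      unfolding m_def by simp
    then show ?thesis
      using pQ x[OF pQ] unfolding \<zeta>_def Q_def X_def by (simp add: map_id)
  qed
  \<comment> \<open>A point off the rectangle violates one of the two coordinate conditions, so one
    of the two summands is all of \<open>M q\<close> there. Starting from \<open>D\<close> thus
    forces the complement to be everything off \<open>B\<close>.\<close>
  define D where "D = (\<lambda>q. {u + v |u v. u \<in> imgs ((- JS) \<times> UNIV) q \<and> v \<in> imgs (UNIV \<times> (- JT)) q})"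
  have subD: "submod D"
    unfolding D_def by (intro submod_sum submod_imgs_left submod_imgs_below)
  have \<zeta>D: "\<zeta> q \<notin> D q" if q: "q \<in> B" for q
  proof
    assume *: "\<zeta> q \<in> D q"
    \<comment> \<open>If the generator met \<open>D\<close> at \<open>q\<close>, it would also meet
      it at the join of \<open>q\<close> and \<open>p\<close>, where its value is the image of
      \<open>z\<close>.\<close>
    define t where "t = (max (fst q) (fst p), max (snd q) (snd p))"
    have t: "t \<in> B" "q \<le> t" "p \<le> t"
      using max_B[of q p] q p unfolding t_def B_def[symmetric] by (auto simp: less_eq_prod_def)
    have "f q t (\<zeta> q) \<in> D t"
      using submodD(3)[OF subD t(2) *] .
    moreover have "f q t (\<zeta> q) = f p t z"
      using \<zeta>f[OF q t(2)] \<zeta>f[of p t] t(3) p \<zeta>p unfolding B_def by simp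
    ultimately show False
      using avoid[of t] t unfolding D_def B_def by force
  qed
  have supp: "\<zeta> q \<noteq> 0 \<longleftrightarrow> q \<in> B" for q
  proof (cases "q \<in> B")
    case True
    then have "\<zeta> q \<noteq> 0"
      using \<zeta>D[OF True] subspace_0[OF submodD(1)[OF subD], of q] by metis
    then show ?thesis
      using True by simp
  qed (simp add: \<zeta>_def)
  have gen: "generator \<zeta>"
    unfolding generator_def using \<zeta>M \<zeta>f supp by blast
  obtain C where "splits \<zeta> C"
  proof (rule generator_splits[OF gen subD])
    fix q assume "\<zeta> q = 0"
    then have "q \<in> (- JS) \<times> UNIV \<or> q \<in> UNIV \<times> (- JT)"
      using supp[of q] unfolding B_def by (cases q) auto
    then have "M q \<subseteq> imgs ((- JS) \<times> UNIV) q \<or> M q \<subseteq> imgs (UNIV \<times> (- JT)) q"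
      by (elim disj_forward imgs_eq)
    moreover have "0 \<in> imgs K q" for K
      unfolding imgs_def by simp
    ultimately show "M q \<subseteq> D q"
      unfolding D_def by force
  next
    fix q assume "\<zeta> q \<noteq> 0"
    then show "\<zeta> q \<notin> D q"
      using \<zeta>D supp by blast
  next
    fix q r assume "\<zeta> q \<noteq> 0" "\<zeta> r \<noteq> 0"
    then have "(max (fst q) (fst r), max (snd q) (snd r)) \<in> B"
      using max_B supp by blast
    then show "\<exists>t. q \<le> t \<and> r \<le> t \<and> \<zeta> t \<noteq> 0"
      using supp by (intro exI[of _ "(max (fst q) (fst r), max (snd q) (snd r))"])
        (auto simp: less_eq_prod_def)
  qed blast
  moreover have "{q. \<zeta> q \<noteq> 0} = JS \<times> JT"
    using supp unfolding B_def by blast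
  ultimately show ?thesis
    by (rule that)
qed

text \<open>Middle exactness is symmetric in the two coordinates, with \<open>u\<close> and
  \<open>v\<close> exchanged. Transposing yields leftward lifts from downward ones and horizontal
  bands from vertical ones.\<close>

lemma swap_middle_exact_mod:
  "middle_exact_mod s (\<lambda>q. M (prod.swap q)) (\<lambda>q r. f (prod.swap q) (prod.swap r))"
proof -
  have le: "prod.swap p \<le> prod.swap q" if "p \<le> q" for p q :: "'t \<times> 's"
    using that by (simp add: less_eq_prod_def)
  show ?thesis
  proof
    fix x x' :: 't and y y' :: 's and u v
    assume *: "x \<le> x'" "y \<le> y'" "u \<in> M (prod.swap (x, y'))" "v \<in> M (prod.swap (x', y))"
      "f (prod.swap (x, y')) (prod.swap (x', y')) u = f (prod.swap (x', y)) (prod.swap (x', y')) v"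
    show "\<exists>w\<in>M (prod.swap (x, y)). f (prod.swap (x, y)) (prod.swap (x, y')) w = u \<and>
        f (prod.swap (x, y)) (prod.swap (x', y)) w = v"
      using exact[OF *(2,1), of v u] * by auto
  qed (auto simp: le map_in map_add map_scale map_id map_comp pfd subspace_M)
qed

text \<open>This is the weak pullback with zero in the corner \<open>(x', y)\<close>: an element
  that dies horizontally extends downwards without limit and still dies at the same column.\<close>

lemma lift_down:
  assumes "x \<le> x'" "y1 \<le> y" "u \<in> M (x, y)" "f (x, y) (x', y) u = 0"
  shows "\<exists>w\<in>M (x, y1). f (x, y1) (x, y) w = u \<and> f (x, y1) (x', y1) w = 0"
  using exact[of x x' y1 y u 0] assms by simp

text \<open>The set \<open>X\<close> need not have a least element. The kernels towards its columns
  form a chain of subspaces of one finite-dimensional space, so one of them is least, and a lift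
  dying at the corresponding column dies at all others.\<close>

lemma lift_down_all:
  assumes "y1 \<le> y" "u \<in> M (x, y)" "X \<noteq> {}"
    and X: "\<And>x'. x' \<in> X \<Longrightarrow> x \<le> x' \<and> f (x, y) (x', y) u = 0"
  shows "\<exists>w\<in>M (x, y1). f (x, y1) (x, y) w = u \<and> (\<forall>x'\<in>X. f (x, y1) (x', y1) w = 0)"
proof -
  define \<A> where "\<A> = (\<lambda>x'. ker (x, y1) (x', y1)) ` X"
  have "\<A> \<noteq> {}"
    using assms unfolding \<A>_def by blast
  moreover have "subspace A \<and> A \<subseteq> M (x, y1)" if "A \<in> \<A>" for A
    using that X subspace_ker unfolding \<A>_def by (auto simp: ker_def)
  ultimately obtain A where A: "A \<in> \<A>" "\<forall>A'\<in>\<A>. A' \<subseteq> A \<longrightarrow> A' = A"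
    using subspace_minimal by metis
  then obtain x0 where x0: "x0 \<in> X" "A = ker (x, y1) (x0, y1)"
    unfolding \<A>_def by blast
  have least: "A \<subseteq> ker (x, y1) (x', y1)" if x': "x' \<in> X" for x'
  proof (cases "x0 \<le> x'")
    case True
    then show ?thesis
      using X[OF x0(1)] unfolding x0(2) by (intro ker_mono) auto
  next
    case False
    then have "ker (x, y1) (x', y1) \<subseteq> A"
      using X[OF x'] unfolding x0(2) by (intro ker_mono) auto
    then show ?thesis
      using A(2) x' unfolding \<A>_def by blast
  qed
  obtain w where w: "w \<in> M (x, y1)" "f (x, y1) (x, y) w = u" "f (x, y1) (x0, y1) w = 0"
    using lift_down[of x x0 y1 y u] X[OF x0(1)] assms by blast
  then have "w \<in> A"
    unfolding x0(2) ker_def by blast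
  then show ?thesis
    using w least unfolding ker_def by blast
qed

lemma lift_left_all:
  assumes "x1 \<le> x" "u \<in> M (x, y)" "Y \<noteq> {}"
    and Y: "\<And>y'. y' \<in> Y \<Longrightarrow> y \<le> y' \<and> f (x, y) (x, y') u = 0"
  shows "\<exists>w\<in>M (x1, y). f (x1, y) (x, y) w = u \<and> (\<forall>y'\<in>Y. f (x1, y) (x1, y') w = 0)"
proof -
  interpret S: middle_exact_mod s "\<lambda>q. M (prod.swap q)" "\<lambda>q r. f (prod.swap q) (prod.swap r)"
    by (rule swap_middle_exact_mod)
  show ?thesis
    using S.lift_down_all[of x1 x u y Y] assms by simp
qed

section \<open>Death blocks, bands and birth blocks\<close>

text \<open>Let \<open>N\<close> be the space of elements at \<open>(x, y)\<close> dying in both directions. Choosing \<open>z\<close> in the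
  smallest non-zero kernel within \<open>N\<close> makes its support above \<open>(x, y)\<close> a rectangle.\<close>

lemma death_block_splits:
  assumes z0: "z0 \<in> M (x, y)" "z0 \<noteq> 0" "x \<le> x1" "f (x, y) (x1, y) z0 = 0"
    "y \<le> y1" "f (x, y) (x, y1) z0 = 0"
  obtains \<zeta> C JS JT where "splits \<zeta> C" "{q. \<zeta> q \<noteq> 0} = JS \<times> JT"
    "interval_ideal JS" "interval_ideal JT"
proof -
  define N where "N = {w \<in> M (x, y). (\<exists>x'\<ge>x. f (x, y) (x', y) w = 0) \<and> (\<exists>y'\<ge>y. f (x, y) (x, y') w = 0)}"
  have die_r: "f (x, y) (x'', y) w = 0" if "w \<in> M (x, y)" "f (x, y) (x', y) w = 0" "x \<le> x'" "x' \<le> x''" for w x' x''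
    using map_comp[of "(x, y)" "(x', y)" "(x'', y)" w] that by simp
  have die_u: "f (x, y) (x, y'') w = 0" if "w \<in> M (x, y)" "f (x, y) (x, y') w = 0" "y \<le> y'" "y' \<le> y''" for w y' y''
    using map_comp[of "(x, y)" "(x, y')" "(x, y'')" w] that by simp
  have subN: "subspace N"
  proof (rule subspaceI)
    show "0 \<in> N"
      unfolding N_def by auto
    show "s c w \<in> N" if "w \<in> N" for c w
      using that unfolding N_def by (auto simp: map_scale M_scale)
    show "v + w \<in> N" if vw: "v \<in> N" "w \<in> N" for v w
    proof -
      obtain a b c d where *: "v \<in> M (x, y)" "w \<in> M (x, y)" "x \<le> a" "f (x, y) (a, y) v = 0"
        "x \<le> b" "f (x, y) (b, y) w = 0" "y \<le> c" "f (x, y) (x, c) v = 0"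
        "y \<le> d" "f (x, y) (x, d) w = 0"
        using vw unfolding N_def by blast
      have "f (x, y) (max a b, y) (v + w) = 0"
        using die_r[OF *(1,4,3), of "max a b"] die_r[OF *(2,6,5), of "max a b"] *
        by (simp add: map_add le_max_iff_disj)
      moreover have "f (x, y) (x, max c d) (v + w) = 0"
        using die_u[OF *(1,8,7), of "max c d"] die_u[OF *(2,10,9), of "max c d"] *
        by (simp add: map_add le_max_iff_disj)
      moreover have "x \<le> max a b" "y \<le> max c d"
        using * by (auto simp: le_max_iff_disj)
      ultimately show ?thesis
        using * unfolding N_def by (auto intro!: M_add)
    qed
  qed
  define \<A> where "\<A> = {ker (x, y) (x', y) \<inter> N |x'. x \<le> x' \<and> ker (x, y) (x', y) \<inter> N \<noteq> {0}}"
  have "z0 \<in> ker (x, y) (x1, y) \<inter> N"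
    using z0 unfolding N_def ker_def by auto
  then have "\<A> \<noteq> {}"
    unfolding \<A>_def using z0 by blast
  moreover have "subspace A \<and> A \<subseteq> M (x, y)" if "A \<in> \<A>" for A
    using that subN subspace_ker unfolding \<A>_def by (auto simp: ker_def intro!: subspace_inter)
  ultimately obtain A where A: "A \<in> \<A>" "\<forall>A'\<in>\<A>. A' \<subseteq> A \<longrightarrow> A' = A"
    using subspace_minimal by metis
  then obtain x0 where x0: "x \<le> x0" "A = ker (x, y) (x0, y) \<inter> N" "A \<noteq> {0}"
    unfolding \<A>_def by blast
  have "0 \<in> A"
    using x0 subspace_ker[of "(x, y)" "(x0, y)"] subN by (auto intro: subspace_0)
  then obtain z where zA: "z \<in> A" and zn: "z \<noteq> 0"
    using x0(3) by blast
  have zN: "z \<in> N" and zM: "z \<in> M (x, y)" and zx0: "f (x, y) (x0, y) z = 0"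
    using zA unfolding x0(2) N_def ker_def by auto
  \<comment> \<open>If \<open>z\<close> survives to \<open>c\<close>, the kernel towards
    \<open>c\<close> misses \<open>z\<close> and is therefore a proper part of \<open>A\<close>
    within \<open>N\<close>; minimality leaves only zero.\<close>
  have trivial: "w = 0" if w: "x \<le> c" "f (x, y) (c, y) z \<noteq> 0" "w \<in> N" "f (x, y) (c, y) w = 0" for w c
  proof (rule ccontr)
    assume "w \<noteq> 0"
    have "c \<le> x0"
      using die_r[OF zM zx0 x0(1), of c] w(2) linear by blast
    then have "ker (x, y) (c, y) \<inter> N \<subseteq> A"
      using ker_mono[of "(x, y)" "(c, y)" "(x0, y)"] w unfolding x0(2) by auto
    moreover have "w \<in> ker (x, y) (c, y) \<inter> N"
      using w unfolding ker_def N_def by blast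
    then have "ker (x, y) (c, y) \<inter> N \<in> \<A>"
      unfolding \<A>_def using w(1) \<open>w \<noteq> 0\<close> by blast
    ultimately have "ker (x, y) (c, y) \<inter> N = A"
      using A(2) by blast
    then show False
      using zA w(2) unfolding ker_def by blast
  qed
  \<comment> \<open>The implication admits every coordinate left of \<open>x\<close>: since
    \<open>z\<close> dies vertically, it lifts arbitrarily far to the left. Dually, dying
    horizontally lets it lift arbitrarily far down, whence the form of \<open>JT\<close>.\<close>
  define JS where "JS = {x'. x \<le> x' \<longrightarrow> f (x, y) (x', y) z \<noteq> 0}"
  define JT where "JT = {y'. y \<le> y' \<longrightarrow> f (x, y) (x, y') z \<noteq> 0}"
  have JS: "interval_ideal JS"
    unfolding interval_ideal_def
  proof (intro conjI allI impI)
    show "JS \<noteq> {}"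
      using zn zM unfolding JS_def by (auto simp: map_id intro!: exI[of _ x])
    show "a \<in> JS" if "b \<in> JS" "a \<le> b" for a b
      using that die_r[OF zM, of a b] unfolding JS_def by force
  qed
  have JT: "interval_ideal JT"
    unfolding interval_ideal_def
  proof (intro conjI allI impI)
    show "JT \<noteq> {}"
      using zn zM unfolding JT_def by (auto simp: map_id intro!: exI[of _ y])
    show "a \<in> JT" if "b \<in> JT" "a \<le> b" for a b
      using that die_u[OF zM, of a b] unfolding JT_def by force
  qed
  have JSdown: "a \<in> JS" if "b \<in> JS" "a \<le> b" for a b
    using JS that unfolding interval_ideal_def by blast
  have JTdown: "a \<in> JT" if "b \<in> JT" "a \<le> b" for a b
    using JT that unfolding interval_ideal_def by blast
  show ?thesis
  proof (rule rectangle_splits)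
    show "(x, y) \<in> JS \<times> JT"
      using zn zM unfolding JS_def JT_def by (simp add: map_id)
    show "z \<in> M (x, y)"
      by (rule zM)
  next
    fix q assume q: "q \<in> JS \<times> JT" "q \<le> (x, y)"
    obtain a b where ab: "q = (a, b)" "a \<le> x" "b \<le> y" "a \<in> JS" "b \<in> JT"
      using q by (cases q) auto
    have "- JT \<noteq> {}" "- JS \<noteq> {}"
      using zN unfolding N_def JT_def JS_def by auto
    have Y: "y \<le> y' \<and> f (x, y) (x, y') z = 0" if "y' \<in> - JT" for y'
      using that unfolding JT_def by simp
    \<comment> \<open>The lift goes left first, keeping the vertical deaths, and then down, keeping
      the horizontal ones. The vertical deaths survive the second step because every height outside
      \<open>JT\<close> is at least \<open>y\<close>, so the column map factors through
      \<open>w1\<close>.\<close>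
    obtain w1 where w1: "w1 \<in> M (a, y)" "f (a, y) (x, y) w1 = z" "\<forall>y'\<in>- JT. f (a, y) (a, y') w1 = 0"
      using lift_left_all[OF ab(2) zM \<open>- JT \<noteq> {}\<close> Y] by blast
    have X: "a \<le> x' \<and> f (a, y) (x', y) w1 = 0" if "x' \<in> - JS" for x'
    proof -
      have "x \<le> x'" "f (x, y) (x', y) z = 0"
        using that unfolding JS_def by auto
      then show ?thesis
        using ab w1 map_comp[of "(a, y)" "(x, y)" "(x', y)" w1] by simp
    qed
    obtain w where w: "w \<in> M (a, b)" "f (a, b) (a, y) w = w1" "\<forall>x'\<in>- JS. f (a, b) (x', b) w = 0"
      using lift_down_all[OF ab(3) w1(1) \<open>- JS \<noteq> {}\<close> X] by blast
    have "f (a, b) (x, y) w = z"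
      using map_comp[of "(a, b)" "(a, y)" "(x, y)" w] w w1 ab by simp
    moreover have "f (a, b) r w = 0" if r: "(a, b) \<le> r" "r \<notin> JS \<times> JT" for r
    proof -
      obtain c d where cd: "r = (c, d)" "a \<le> c" "b \<le> d"
        using r by (cases r) auto
      consider "c \<notin> JS" | "d \<notin> JT"
        using r cd by auto
      then show ?thesis
      proof cases
        case 1
        then show ?thesis
          using map_comp[of "(a, b)" "(c, b)" "(c, d)" w] w cd by simp
      next
        case 2
        then have "y \<le> d"
          unfolding JT_def by blast
        then have "f (a, b) (a, d) w = 0"
          using map_comp[of "(a, b)" "(a, y)" "(a, d)" w] w w1 ab 2 by simp
        then show ?thesis
          using map_comp[of "(a, b)" "(a, d)" "(c, d)" w] w cd by simp
      qed
    qed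
    ultimately show "\<exists>w\<in>M q. f q (x, y) w = z \<and> (\<forall>r. q \<le> r \<longrightarrow> r \<notin> JS \<times> JT \<longrightarrow> f q r w = 0)"
      using w(1) unfolding ab(1) by blast
  next
    fix q u v
    assume q: "q \<in> JS \<times> JT" "(x, y) \<le> q"
      and u: "u \<in> imgs ((- JS) \<times> UNIV) q" and v: "v \<in> imgs (UNIV \<times> (- JT)) q"
    obtain c d where cd: "q = (c, d)" "x \<le> c" "y \<le> d" "c \<in> JS" "d \<in> JT"
      using q by (cases q) auto
    \<comment> \<open>Both factors are closed downwards, so nothing enters the rectangle from
      outside; it remains to see that \<open>z\<close> is alive at \<open>(c, d)\<close>.\<close>
    have "u = 0"
      using u JSdown[OF cd(4)] unfolding imgs_def cd(1) by auto
    moreover have "v = 0"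
      using v JTdown[OF cd(5)] unfolding imgs_def cd(1) by auto
    moreover have "f (x, y) (c, d) z \<noteq> 0"
    proof
      assume zero: "f (x, y) (c, d) z = 0"
      \<comment> \<open>If \<open>z\<close> died at \<open>(c, d)\<close>, its image at
        \<open>(x, d)\<close> would die horizontally and lift down to some \<open>w\<close> killed
        at \<open>c\<close>. Once \<open>w\<close> is known to lie in \<open>N\<close>, it is zero
        by \<open>trivial\<close>, and so \<open>z\<close> already dies at height \<open>d\<close>,
        contrary to \<open>d\<close> being in \<open>JT\<close>.\<close>
      define u' where "u' = f (x, y) (x, d) z"
      have "u' \<in> M (x, d)" "f (x, d) (c, d) u' = 0"
        unfolding u'_def using zM cd zero by (auto simp: map_in map_comp)
      then obtain w where w: "w \<in> M (x, y)" "f (x, y) (x, d) w = u'" "f (x, y) (c, y) w = 0"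
        using lift_down[OF cd(2,3)] by blast
      have "z - w \<in> M (x, y)" "f (x, y) (x, d) (z - w) = 0"
        using w zM cd unfolding u'_def by (auto simp: map_diff M_diff)
      \<comment> \<open>Vertical death of \<open>w\<close>: it agrees with \<open>z\<close> from
        height \<open>d\<close> on, and \<open>z\<close> is dead from height \<open>e\<close>
        on.\<close>
      obtain e where e: "y \<le> e" "f (x, y) (x, e) z = 0"
        using zN unfolding N_def by blast
      have "f (x, y) (x, max d e) (z - w) = 0"
        by (rule die_u[of _ d]) (use cd \<open>z - w \<in> M (x, y)\<close> \<open>f (x, y) (x, d) (z - w) = 0\<close> in auto)
      moreover have "f (x, y) (x, max d e) z = 0"
        by (rule die_u[of _ e]) (use e zM in auto)
      ultimately have "f (x, y) (x, max d e) w = 0"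
        using map_diff[of "(x, y)" "(x, max d e)" z w] zM w e by (simp add: le_max_iff_disj)
      moreover have "y \<le> max d e"
        using e by (simp add: le_max_iff_disj)
      ultimately have "w \<in> N"
        using w cd unfolding N_def by blast
      then have "w = 0"
        using trivial[of c w] cd w unfolding JS_def by blast
      then have "f (x, y) (x, d) z = 0"
        using w cd unfolding u'_def by simp
      then show False
        using cd unfolding JT_def by blast
    qed
    ultimately show "f (x, y) q z \<noteq> u + v"
      using cd by simp
  qed (use that JS JT in blast)
qed

text \<open>Choosing \<open>z\<close> in the smallest non-zero kernel forces all horizontal maps inside the band to be
  injective on its column.\<close>

lemma vertical_band_splits:
  assumes noN: "\<And>x y w x1 y1. \<lbrakk>w \<in> M (x, y); x \<le> x1; f (x, y) (x1, y) w = 0; y \<le> y1;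
      f (x, y) (x, y1) w = 0\<rbrakk> \<Longrightarrow> w = 0"
    and z0: "z0 \<in> M (x, y)" "z0 \<noteq> 0" "x \<le> x1" "f (x, y) (x1, y) z0 = 0"
  obtains \<zeta> C J where "splits \<zeta> C" "{q. \<zeta> q \<noteq> 0} = J \<times> UNIV" "interval J"
proof -
  define \<A> where "\<A> = {ker (x, y) (x', y) |x'. x \<le> x' \<and> ker (x, y) (x', y) \<noteq> {0}}"
  have "z0 \<in> ker (x, y) (x1, y)"
    using z0 unfolding ker_def by auto
  then have "\<A> \<noteq> {}"
    unfolding \<A>_def using z0 by blast
  moreover have "subspace A \<and> A \<subseteq> M (x, y)" if "A \<in> \<A>" for A
    using that subspace_ker unfolding \<A>_def by (auto simp: ker_def)
  ultimately obtain A where A: "A \<in> \<A>" "\<forall>A'\<in>\<A>. A' \<subseteq> A \<longrightarrow> A' = A"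
    using subspace_minimal by metis
  then obtain x0 where x0: "x \<le> x0" "A = ker (x, y) (x0, y)" "A \<noteq> {0}"
    unfolding \<A>_def by blast
  have "0 \<in> A"
    using x0 subspace_ker[of "(x, y)" "(x0, y)"] by (auto intro: subspace_0)
  then obtain z where zA: "z \<in> A" and zn: "z \<noteq> 0"
    using x0(3) by blast
  have zM: "z \<in> M (x, y)" and zx0: "f (x, y) (x0, y) z = 0"
    using zA unfolding x0(2) ker_def by auto
  have die_r: "f (x, y) (x'', y) w = 0" if "w \<in> M (x, y)" "f (x, y) (x', y) w = 0" "x \<le> x'" "x' \<le> x''" for w x' x''
    using map_comp[of "(x, y)" "(x', y)" "(x'', y)" w] that by simp
  have trivial: "w = 0" if w: "x \<le> c" "f (x, y) (c, y) z \<noteq> 0" "w \<in> M (x, y)" "f (x, y) (c, y) w = 0" for w c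
  proof (rule ccontr)
    assume "w \<noteq> 0"
    have "c \<le> x0"
      using die_r[OF zM zx0 x0(1), of c] w(2) linear by blast
    then have "ker (x, y) (c, y) \<subseteq> A"
      using ker_mono[of "(x, y)" "(c, y)" "(x0, y)"] w unfolding x0(2) by auto
    moreover have "w \<in> ker (x, y) (c, y)"
      using w unfolding ker_def by blast
    then have "ker (x, y) (c, y) \<in> \<A>"
      unfolding \<A>_def using w(1) \<open>w \<noteq> 0\<close> by blast
    ultimately have "ker (x, y) (c, y) = A"
      using A(2) by blast
    then show False
      using zA w(2) unfolding ker_def by blast
  qed
  \<comment> \<open>To the right of \<open>x\<close> the band extends as long as \<open>z\<close>
    survives, to the left as far as \<open>z\<close> lifts within its row. There is no vertical
    limit: \<open>z\<close> lifts downwards because it dies horizontally, and it survives upwards by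
    \<open>noN\<close>.\<close>
  define J where "J = {x'. (x \<le> x' \<and> f (x, y) (x', y) z \<noteq> 0) \<or> (x' \<le> x \<and> z \<in> f (x', y) (x, y) ` M (x', y))}"
  have zself: "f (x, y) (x, y) z = z" "z \<in> f (x, y) (x, y) ` M (x, y)"
    using zM map_id[OF zM] by force+
  have xJ: "x \<in> J"
    using zself zn unfolding J_def by simp
  have Jr: "f (x, y) (c, y) z \<noteq> 0" if "c \<in> J" "x \<le> c" for c
    using that zself zn unfolding J_def by auto
  have Jl: "z \<in> f (c, y) (x, y) ` M (c, y)" if "c \<in> J" "c \<le> x" for c
    using that zself unfolding J_def by auto
  have J: "b \<in> J" if abc: "a \<in> J" "c \<in> J" "a \<le> b" "b \<le> c" for a b c
  proof (cases "x \<le> b")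
    case True
    then show ?thesis
      using Jr[OF abc(2)] die_r[OF zM, of b c] abc unfolding J_def by auto
  next
    case False
    then have "a \<le> x"
      using abc by auto
    then obtain m where "m \<in> M (a, y)" "z = f (a, y) (x, y) m"
      using Jl[OF abc(1)] by blast
    then have "z = f (b, y) (x, y) (f (a, y) (b, y) m)" "f (a, y) (b, y) m \<in> M (b, y)"
      using abc False by (auto simp: map_comp map_in)
    then show ?thesis
      using False unfolding J_def by auto
  qed
  have x0J: "x0 \<notin> J"
    using Jr x0(1) zx0 by blast
  show ?thesis
  proof (rule rectangle_splits)
    show "(x, y) \<in> J \<times> UNIV" "z \<in> M (x, y)"
      using xJ zM by auto
  next
    fix q assume q: "q \<in> J \<times> UNIV" "q \<le> (x, y)"
    obtain a b where ab: "q = (a, b)" "a \<le> x" "b \<le> y" "a \<in> J"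
      using q by (cases q) auto
    obtain w1 where w1: "w1 \<in> M (a, y)" "f (a, y) (x, y) w1 = z"
      using Jl[OF ab(4,2)] by blast
    \<comment> \<open>Lifts have to die only at columns right of the band, since a column off
      \<open>J\<close> to the right of \<open>a\<close> cannot lie left of \<open>x\<close> by
      convexity.\<close>
    define X where "X = {x'. x' \<notin> J \<and> x \<le> x'}"
    have "X \<noteq> {}"
      unfolding X_def using x0J x0(1) by blast
    have X: "a \<le> x' \<and> f (a, y) (x', y) w1 = 0" if "x' \<in> X" for x'
    proof -
      have "x \<le> x'" "f (x, y) (x', y) z = 0"
        using that unfolding X_def J_def by auto
      then show ?thesis
        using ab w1 map_comp[of "(a, y)" "(x, y)" "(x', y)" w1] by simp
    qed
    obtain w where w: "w \<in> M (a, b)" "f (a, b) (a, y) w = w1" "\<forall>x'\<in>X. f (a, b) (x', b) w = 0"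
      using lift_down_all[OF ab(3) w1(1) \<open>X \<noteq> {}\<close> X] by blast
    have "f (a, b) (x, y) w = z"
      using map_comp[of "(a, b)" "(a, y)" "(x, y)" w] w w1 ab by simp
    moreover have "f (a, b) r w = 0" if r: "(a, b) \<le> r" "r \<notin> J \<times> UNIV" for r
    proof -
      obtain c d where cd: "r = (c, d)" "a \<le> c" "b \<le> d" "c \<notin> J"
        using r by (cases r) auto
      then have "c \<in> X"
        using J[OF ab(4) xJ, of c] linear[of c x] unfolding X_def by auto
      then show ?thesis
        using map_comp[of "(a, b)" "(c, b)" "(c, d)" w] w cd by simp
    qed
    ultimately show "\<exists>w\<in>M q. f q (x, y) w = z \<and> (\<forall>r. q \<le> r \<longrightarrow> r \<notin> J \<times> UNIV \<longrightarrow> f q r w = 0)"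
      using w(1) unfolding ab(1) by blast
  next
    fix q u v
    assume q: "q \<in> J \<times> UNIV" "(x, y) \<le> q"
      and u: "u \<in> imgs ((- J) \<times> UNIV) q" and v: "v \<in> imgs (UNIV \<times> (- UNIV)) q"
    obtain c d where cd: "q = (c, d)" "x \<le> c" "y \<le> d" "c \<in> J"
      using q by (cases q) auto
    \<comment> \<open>An element at height \<open>d\<close> killed on the way to \<open>c\<close>
      lifts down to the row of \<open>z\<close>, still killed at \<open>c\<close>, and there
      \<open>trivial\<close> applies.\<close>
    have inj: "t = 0" if t: "t \<in> M (x, d)" "f (x, d) (c, d) t = 0" for t
    proof -
      obtain w where w: "w \<in> M (x, y)" "f (x, y) (x, d) w = t" "f (x, y) (c, y) w = 0"
        using lift_down[OF cd(2,3) t] by blast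
      then have "w = 0"
        using trivial[OF cd(2) Jr[OF cd(4,2)]] by blast
      then show ?thesis
        using w cd by simp
    qed
    define z' where "z' = f (x, y) (x, d) z"
    have z': "z' \<in> M (x, d)" "f (x, d) (c, d) z' = f (x, y) (c, d) z"
      unfolding z'_def using zM cd by (auto simp: map_in map_comp)
    have "v = 0"
      using v unfolding imgs_def by simp
    moreover have "f (x, y) (c, d) z \<noteq> u"
    proof
      assume zu: "f (x, y) (c, d) z = u"
      show False
      proof (cases "u = 0")
        case True
        then have "z' = 0"
          using inj z' zu by simp
        then have "z = 0"
          using noN[OF zM x0(1) zx0 cd(3)] unfolding z'_def by blast
        then show False
          using zn by blast
      next
        case False
        then obtain e g m where m: "e \<notin> J" "e \<le> c" "g \<le> d" "m \<in> M (e, g)" "u = f (e, g) (c, d) m"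
          using u unfolding imgs_def cd(1) by auto
        have ex: "e \<le> x"
          using J[OF xJ cd(4), of e] linear[of e x] m by auto
        \<comment> \<open>An element entering from a column \<open>e\<close> left of the band is
          first raised to height \<open>d\<close> and then moved to column \<open>x\<close>. By
          injectivity it equals the image of \<open>z\<close> there, so middle exactness lifts
          \<open>z\<close> to \<open>(e, y)\<close> and puts \<open>e\<close> into
          \<open>J\<close>.\<close>
        define m' where "m' = f (e, g) (e, d) m"
        have m': "m' \<in> M (e, d)" "f (e, d) (c, d) m' = u"
          unfolding m'_def using m by (auto simp: map_in map_comp)
        define n where "n = f (e, d) (x, d) m'"
        have n: "n \<in> M (x, d)" "f (x, d) (c, d) n = u"
          unfolding n_def using m' ex cd by (auto simp: map_in map_comp)
        have "z' - n = 0"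
        proof (rule inj)
          show "z' - n \<in> M (x, d)"
            using z'(1) n(1) by (rule M_diff)
          show "f (x, d) (c, d) (z' - n) = 0"
            using map_diff[of "(x, d)" "(c, d)" z' n] n z' zu cd(2) by simp
        qed
        then have "f (e, d) (x, d) m' = f (x, y) (x, d) z"
          unfolding z'_def n_def by simp
        then obtain w where "w \<in> M (e, y)" "f (e, y) (x, y) w = z"
          using exact[OF ex cd(3) m'(1) zM] by blast
        then have "e \<in> J"
          using ex unfolding J_def by blast
        then show False
          using m by blast
      qed
    qed
    ultimately show "f (x, y) q z \<noteq> u + v"
      using cd by simp
  next
    fix \<zeta> C assume "splits \<zeta> C" "{q. \<zeta> q \<noteq> 0} = J \<times> UNIV"
    moreover have "interval J"
      unfolding interval_def using xJ J by blast
    ultimately show thesis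
      by (rule that)
  qed
qed

text \<open>When all maps are injective, choosing \<open>z\<close> in the smallest non-zero image from the left makes
  the images entering from outside its filter vanish in the row of \<open>z\<close>.\<close>

lemma birth_block_splits:
  assumes hinj: "\<And>x y w x1. \<lbrakk>w \<in> M (x, y); x \<le> x1; f (x, y) (x1, y) w = 0\<rbrakk> \<Longrightarrow> w = 0"
    and vinj: "\<And>x y w y1. \<lbrakk>w \<in> M (x, y); y \<le> y1; f (x, y) (x, y1) w = 0\<rbrakk> \<Longrightarrow> w = 0"
    and z0: "z0 \<in> M (x, y)" "z0 \<noteq> 0"
  obtains \<zeta> C JS JT where "splits \<zeta> C" "{q. \<zeta> q \<noteq> 0} = JS \<times> JT"
    "interval_filter JS" "interval_filter JT"
proof -
  define Im where "Im = (\<lambda>x'. f (x', y) (x, y) ` M (x', y))"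
  have Im_mono: "Im a \<subseteq> Im b" if "a \<le> b" "b \<le> x" for a b
  proof
    fix m assume "m \<in> Im a"
    then obtain w where "w \<in> M (a, y)" "m = f (a, y) (x, y) w"
      unfolding Im_def by blast
    then have "m = f (b, y) (x, y) (f (a, y) (b, y) w)" "f (a, y) (b, y) w \<in> M (b, y)"
      using that by (auto simp: map_comp map_in)
    then show "m \<in> Im b"
      unfolding Im_def by blast
  qed
  define \<A> where "\<A> = {Im x' |x'. x' \<le> x \<and> Im x' \<noteq> {0}}"
  have "z0 \<in> Im x"
    unfolding Im_def using z0 map_id[OF z0(1)] by force
  then have "\<A> \<noteq> {}"
    unfolding \<A>_def using z0 by blast
  moreover have "subspace A \<and> A \<subseteq> M (x, y)" if "A \<in> \<A>" for A
    using that subspace_image_map unfolding \<A>_def Im_def by (auto intro: map_in)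
  ultimately obtain A where A: "A \<in> \<A>" "\<forall>A'\<in>\<A>. A' \<subseteq> A \<longrightarrow> A' = A"
    using subspace_minimal by metis
  then obtain x0 where x0: "x0 \<le> x" "A = Im x0" "A \<noteq> {0}"
    unfolding \<A>_def by blast
  have "0 \<in> A"
    using x0 subspace_image_map[of "(x0, y)" "(x, y)"] unfolding Im_def by (auto intro: subspace_0)
  then obtain z where zA: "z \<in> A" and zn: "z \<noteq> 0"
    using x0(3) by blast
  have zM: "z \<in> M (x, y)"
    using zA x0 unfolding Im_def by (auto intro: map_in)
  \<comment> \<open>If \<open>z\<close> is not hit from \<open>e\<close>, the image from
    \<open>e\<close> is a proper part of \<open>A\<close>, hence zero; horizontal injectivity then
    makes the whole space at \<open>(e, y)\<close> zero.\<close>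
  have trivial: "w = 0" if e: "e \<le> x" "z \<notin> Im e" and w: "w \<in> M (e, y)" for e w
  proof -
    have "e \<le> x0"
      using Im_mono[of x0 e] e zA x0(2) linear by blast
    then have "Im e \<subseteq> A"
      using Im_mono x0 by blast
    then have "Im e \<notin> \<A>"
      using A(2) zA e(2) by blast
    then have "Im e = {0}"
      unfolding \<A>_def using e by blast
    then have "f (e, y) (x, y) w = 0"
      unfolding Im_def using w by blast
    then show ?thesis
      using hinj w e by blast
  qed
  define JS where "JS = {x'. x' \<le> x \<longrightarrow> z \<in> Im x'}"
  define JT where "JT = {y'. y' \<le> y \<longrightarrow> z \<in> f (x, y') (x, y) ` M (x, y')}"
  have xJ: "x \<in> JS" and yJ: "y \<in> JT"
    unfolding JS_def JT_def Im_def using zM map_id[OF zM] by force+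
  have JSup: "b \<in> JS" if "a \<in> JS" "a \<le> b" for a b
    using that Im_mono[of a b] unfolding JS_def by auto
  have JTup: "b \<in> JT" if ab: "a \<in> JT" "a \<le> b" for a b
    unfolding JT_def
  proof (rule CollectI, rule impI)
    assume b: "b \<le> y"
    then obtain w where "w \<in> M (x, a)" "z = f (x, a) (x, y) w"
      using ab unfolding JT_def by auto
    then have "z = f (x, b) (x, y) (f (x, a) (x, b) w)" "f (x, a) (x, b) w \<in> M (x, b)"
      using ab b by (auto simp: map_comp map_in)
    then show "z \<in> f (x, b) (x, y) ` M (x, b)"
      by blast
  qed
  show ?thesis
  proof (rule rectangle_splits)
    show "(x, y) \<in> JS \<times> JT" "z \<in> M (x, y)"
      using xJ yJ zM by auto
  next
    fix q assume q: "q \<in> JS \<times> JT" "q \<le> (x, y)"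
    obtain a b where ab: "q = (a, b)" "a \<le> x" "b \<le> y" "a \<in> JS" "b \<in> JT"
      using q by (cases q) auto
    obtain m where m: "m \<in> M (a, y)" "f (a, y) (x, y) m = z"
      using ab unfolding JS_def Im_def by blast
    obtain n where n: "n \<in> M (x, b)" "f (x, b) (x, y) n = z"
      using ab unfolding JT_def by blast
    \<comment> \<open>The lifts of \<open>z\<close> along its row and along its column are
      compatible at \<open>(x, y)\<close>, so they have a common lift. Nothing above
      \<open>(a, b)\<close> leaves the block, which makes the dying condition vacuous.\<close>
    obtain w where w: "w \<in> M (a, b)" "f (a, b) (a, y) w = m"
      using exact[OF ab(2,3) m(1) n(1)] m(2) n(2) by auto
    have "f (a, b) (x, y) w = z"
      using map_comp[of "(a, b)" "(a, y)" "(x, y)" w] w m ab by simp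
    moreover have "r \<in> JS \<times> JT" if "(a, b) \<le> r" for r
      using that JSup[OF ab(4)] JTup[OF ab(5)] by (cases r) auto
    ultimately show "\<exists>w\<in>M q. f q (x, y) w = z \<and> (\<forall>r. q \<le> r \<longrightarrow> r \<notin> JS \<times> JT \<longrightarrow> f q r w = 0)"
      using w(1) unfolding ab(1) by blast
  next
    fix q u v
    assume q: "q \<in> JS \<times> JT" "(x, y) \<le> q"
      and u: "u \<in> imgs ((- JS) \<times> UNIV) q" and v: "v \<in> imgs (UNIV \<times> (- JT)) q"
    obtain c d where cd: "q = (c, d)" "x \<le> c" "y \<le> d" "c \<in> JS" "d \<in> JT"
      using q by (cases q) auto
    \<comment> \<open>A non-zero \<open>u\<close> enters from a column \<open>e\<close> outside
      \<open>JS\<close>. If it comes from row \<open>y\<close> at column \<open>c\<close> as well,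
      middle exactness lifts \<open>t\<close> to \<open>(e, y)\<close>, where everything is zero by
      \<open>trivial\<close>. If \<open>u = 0\<close>, vertical injectivity suffices.\<close>
    have row: "t = 0" if t: "t \<in> M (c, y)" "f (c, y) (c, d) t = u" for t
    proof (cases "u = 0")
      case True
      then show ?thesis
        using vinj[OF t(1) cd(3)] t(2) by blast
    next
      case False
      then obtain e g m where m: "e \<notin> JS" "e \<le> c" "g \<le> d" "m \<in> M (e, g)" "u = f (e, g) (c, d) m"
        using u unfolding imgs_def cd(1) by auto
      have "f (e, g) (e, d) m \<in> M (e, d)" "f (e, d) (c, d) (f (e, g) (e, d) m) = f (c, y) (c, d) t"
        using m t by (auto simp: map_in map_comp)
      then obtain w where w: "w \<in> M (e, y)" "f (e, y) (c, y) w = t"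
        using exact[OF m(2) cd(3) _ t(1)] by blast
      then have "w = 0"
        using trivial m(1) unfolding JS_def by blast
      then show ?thesis
        using w m by simp
    qed
    show "f (x, y) q z \<noteq> u + v"
    proof
      assume zuv: "f (x, y) q z = u + v"
      define z' where "z' = f (x, y) (c, y) z"
      have z': "z' \<in> M (c, y)" "f (c, y) (c, d) z' = u + v"
        unfolding z'_def using zM cd zuv by (auto simp: map_in map_comp)
      show False
      proof (cases "v = 0")
        case True
        then have "z' = 0"
          using row z' by simp
        then show False
          using hinj[OF zM cd(2)] zn unfolding z'_def by blast
      next
        case False
        then obtain h k n where n: "k \<notin> JT" "h \<le> c" "k \<le> d" "n \<in> M (h, k)" "v = f (h, k) (c, d) n"
          using v unfolding imgs_def cd(1) by auto
        have ky: "k \<le> y"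
          using n(1) unfolding JT_def by blast
        \<comment> \<open>Moving the source of \<open>v\<close> to column \<open>c\<close> and up to
          row \<open>y\<close> lets it be subtracted from \<open>z'\<close> within that row. The
          difference maps to \<open>u\<close>, so it vanishes by \<open>row\<close>; then
          \<open>z\<close> lifts to height \<open>k\<close>, contradicting the choice of
          \<open>k\<close>.\<close>
        define n' where "n' = f (h, k) (c, k) n"
        have n': "n' \<in> M (c, k)" "f (c, k) (c, d) n' = v"
          unfolding n'_def using n by (auto simp: map_in map_comp)
        have "z' - f (c, k) (c, y) n' = 0"
          using z' n' ky cd by (intro row) (auto simp: map_in map_comp map_diff M_diff)
        then have "f (x, y) (c, y) z = f (c, k) (c, y) n'"
          unfolding z'_def by simp
        then obtain w where "w \<in> M (x, k)" "f (x, k) (x, y) w = z"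
          using exact[OF cd(2) ky zM n'(1)] by blast
        then have "k \<in> JT"
          unfolding JT_def by blast
        then show False
          using n by blast
      qed
    qed
  next
    fix \<zeta> C assume "splits \<zeta> C" "{q. \<zeta> q \<noteq> 0} = JS \<times> JT"
    moreover have "interval_filter JS" "interval_filter JT"
      unfolding interval_filter_def using xJ yJ JSup JTup by blast+
    ultimately show thesis
      by (rule that)
  qed
qed

text \<open>The order of the cases matters: excluding elements that die in both directions is the
  hypothesis \<open>noN\<close> of the band case, and excluding all dying elements leaves injective
  maps. In the first two cases the block grows from a dying element, which may sit at a point other
  than \<open>p\<close>.\<close>

lemma block_splits:
  assumes z0: "z0 \<in> M p" "z0 \<noteq> 0"
  obtains \<zeta> C where "splits \<zeta> C" "is_block {q. \<zeta> q \<noteq> 0}"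
proof -
  obtain x y where p: "p = (x, y)"
    by fastforce
  have ne: "{q. \<zeta> q \<noteq> 0} \<noteq> {}" if "{q. \<zeta> q \<noteq> 0} = JS \<times> JT" "JS \<noteq> {}" "JT \<noteq> {}" for \<zeta> :: "'s \<times> 't \<Rightarrow> 'v" and JS JT
    using that by auto
  show ?thesis
  proof (cases "\<exists>x y w x1 y1. w \<in> M (x, y) \<and> w \<noteq> 0 \<and> x \<le> x1 \<and> f (x, y) (x1, y) w = 0 \<and> y \<le> y1 \<and>
      f (x, y) (x, y1) w = 0")
    case True
    then obtain x y w x1 y1 where "w \<in> M (x, y)" "w \<noteq> 0" "x \<le> x1" "f (x, y) (x1, y) w = 0"
      "y \<le> y1" "f (x, y) (x, y1) w = 0"
      by blast
    then obtain \<zeta> C JS JT where *: "splits \<zeta> C" "{q. \<zeta> q \<noteq> 0} = JS \<times> JT"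
      "interval_ideal JS" "interval_ideal JT"
      by (rule death_block_splits)
    then have "is_block {q. \<zeta> q \<noteq> 0}"
      using ne[OF *(2)] unfolding is_block_def interval_ideal_def by blast
    then show ?thesis
      using * that by blast
  next
    case False
    then have noN: "w = 0" if "w \<in> M (x, y)" "x \<le> x1" "f (x, y) (x1, y) w = 0" "y \<le> y1"
      "f (x, y) (x, y1) w = 0" for x y w x1 y1
      using that by blast
    consider (h) x y w x1 where "w \<in> M (x, y)" "w \<noteq> 0" "x \<le> x1" "f (x, y) (x1, y) w = 0"
      | (v) x y w y1 where "w \<in> M (x, y)" "w \<noteq> 0" "y \<le> y1" "f (x, y) (x, y1) w = 0"
      | (inj) "\<And>x y w x1. \<lbrakk>w \<in> M (x, y); x \<le> x1; f (x, y) (x1, y) w = 0\<rbrakk> \<Longrightarrow> w = 0"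
        "\<And>x y w y1. \<lbrakk>w \<in> M (x, y); y \<le> y1; f (x, y) (x, y1) w = 0\<rbrakk> \<Longrightarrow> w = 0"
      by metis
    then show ?thesis
    proof cases
      case h
      obtain \<zeta> C J where *: "splits \<zeta> C" "{q. \<zeta> q \<noteq> 0} = J \<times> UNIV" "interval J"
        by (rule vertical_band_splits[OF noN h]) blast+
      then have "is_block {q. \<zeta> q \<noteq> 0}"
        using ne[OF *(2)] unfolding is_block_def interval_def by blast
      then show ?thesis
        using * that by blast
    next
      case v
      \<comment> \<open>Transposition turns vertical death into horizontal death, and
        \<open>noN\<close> is symmetric, so the vertical band construction applies and is
        transported back along \<open>prod.swap\<close>.\<close>
      interpret S: middle_exact_mod s "\<lambda>q. M (prod.swap q)" "\<lambda>q r. f (prod.swap q) (prod.swap r)"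
        by (rule swap_middle_exact_mod)
      obtain \<zeta>' C' J where *: "S.splits \<zeta>' C'" "{q. \<zeta>' q \<noteq> 0} = J \<times> UNIV" "interval J"
      proof (rule S.vertical_band_splits)
        show "w \<in> M (prod.swap (y, x))" "w \<noteq> 0" "y \<le> y1" "f (prod.swap (y, x)) (prod.swap (y1, x)) w = 0"
          using v by auto
        show "w = 0" if "w \<in> M (prod.swap (x, y))" "x \<le> x1"
          "f (prod.swap (x, y)) (prod.swap (x1, y)) w = 0" "y \<le> y1"
          "f (prod.swap (x, y)) (prod.swap (x, y1)) w = 0" for x y w x1 y1
          using noN[of w y x y1 x1] that by simp
      qed blast
      define \<zeta> C where "\<zeta> = (\<lambda>q. \<zeta>' (prod.swap q))" and "C = (\<lambda>q. C' (prod.swap q))"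
      have le: "prod.swap q \<le> prod.swap r" if "q \<le> r" for q r :: "'s \<times> 't"
        using that by (simp add: less_eq_prod_def)
      have gen: "generator \<zeta>"
        using *(1) le unfolding S.splits_def S.generator_def generator_def \<zeta>_def
        by (metis swap_swap)
      have sub: "submod C"
        using *(1) le unfolding S.splits_def S.submod_def submod_def C_def
        by (metis swap_swap)
      have "splits \<zeta> C"
        using *(1) gen sub unfolding S.splits_def splits_def \<zeta>_def C_def
        by (metis swap_swap)
      moreover have supp: "{q. \<zeta> q \<noteq> 0} = UNIV \<times> J"
        using *(2) unfolding \<zeta>_def by (auto simp: set_eq_iff)
      then have "is_block {q. \<zeta> q \<noteq> 0}"
        using ne[OF supp] *(3) unfolding is_block_def interval_def by blast
      ultimately show ?thesis
        using that by blast
    next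
      case inj
      obtain \<zeta> C JS JT where *: "splits \<zeta> C" "{q. \<zeta> q \<noteq> 0} = JS \<times> JT"
        "interval_filter JS" "interval_filter JT"
        by (rule birth_block_splits[OF inj z0[unfolded p]]) blast+
      then have "is_block {q. \<zeta> q \<noteq> 0}"
        using ne[OF *(2)] unfolding is_block_def interval_filter_def by blast
      then show ?thesis
        using * that by blast
    qed
  qed
qed

end

section \<open>Decomposition into blocks\<close>

context pers_mod
begin

text \<open>This says that \<open>M p\<close> is the direct sum of \<open>V\<close> and the lines
  through the values at \<open>p\<close> of the members of \<open>E\<close>. As \<open>E\<close>
  consists of functions, injectivity of evaluation has to be demanded separately: two members
  agreeing at \<open>p\<close> would otherwise count as one vector.\<close>

definition decomp :: "'p \<Rightarrow> ('p \<Rightarrow> 'v) set \<Rightarrow> 'v set \<Rightarrow> bool" where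
  "decomp p E V \<longleftrightarrow> inj_on (\<lambda>z. z p) E \<and> independent ((\<lambda>z. z p) ` E) \<and>
     span ((\<lambda>z. z p) ` E) \<inter> V = {0} \<and> (\<forall>m\<in>M p. \<exists>n\<in>span ((\<lambda>z. z p) ` E). m - n \<in> V)"

lemma submod_M: "submod M"
  unfolding submod_def using subspace_M map_in by blast

lemma decomp_M: "decomp p {} (M p)"
  unfolding decomp_def using independent_empty by auto

lemma generator_span:
  assumes gen: "\<And>z. z \<in> F \<Longrightarrow> generator z" and pq: "p \<le> q"
    and n: "n \<in> span ((\<lambda>z. z p) ` {z \<in> F. z p \<noteq> 0})"
  shows "n \<in> M p" "f p q n \<in> span ((\<lambda>z. z q) ` {z \<in> F. z q \<noteq> 0})"
proof -
  define W where "W = {n \<in> M p. f p q n \<in> span ((\<lambda>z. z q) ` {z \<in> F. z q \<noteq> 0})}"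
  have "subspace W"
    unfolding W_def using pq
    by (intro subspaceI) (auto simp: map_add map_scale M_add M_scale span_add span_scale span_zero)
  moreover have "z p \<in> W" if z: "z \<in> F" "z p \<noteq> 0" for z
  proof -
    have "z p \<in> M p" "f p q (z p) = z q"
      using gen[OF z(1)] z(2) pq unfolding generator_def by auto
    moreover have "z q \<in> span ((\<lambda>z. z q) ` {z \<in> F. z q \<noteq> 0})"
      using z(1) by (cases "z q = 0") (auto intro: span_base simp: span_zero)
    ultimately show ?thesis
      unfolding W_def by simp
  qed
  ultimately have "span ((\<lambda>z. z p) ` {z \<in> F. z p \<noteq> 0}) \<subseteq> W"
    by (intro span_minimal) auto
  then show "n \<in> M p" "f p q n \<in> span ((\<lambda>z. z q) ` {z \<in> F. z q \<noteq> 0})"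
    using n unfolding W_def by auto
qed

lemma decomp_insert:
  assumes E: "decomp p E V" and V: "subspace V" and z: "z p \<in> V" "z p \<notin> V'"
    and V': "subspace V'" "V' \<subseteq> V" "\<And>m. m \<in> V \<Longrightarrow> \<exists>c. m - s c (z p) \<in> V'"
  shows "decomp p (insert z E) V'"
proof -
  define b where "b = (\<lambda>z. z p) ` E"
  have inj: "inj_on (\<lambda>z. z p) E" and ind: "independent b" and int: "\<And>x. x \<in> span b \<Longrightarrow> x \<in> V \<Longrightarrow> x = 0"
    and cov: "\<And>m. m \<in> M p \<Longrightarrow> \<exists>n\<in>span b. m - n \<in> V"
    using E unfolding decomp_def b_def by auto
  have zn: "z p \<noteq> 0"
    using z subspace_0[OF V'(1)] by metis
  then have zb: "z p \<notin> span b"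
    using int z(1) by blast
  then have zb': "z p \<notin> b"
    using span_base by blast
  have "inj_on (\<lambda>z. z p) (insert z E)"
    using inj zb' unfolding b_def by auto
  moreover have "independent (insert (z p) b)"
    using zb ind by (rule independent_insertI)
  moreover have "x = 0" if x: "x \<in> span (insert (z p) b)" "x \<in> V'" for x
  proof -
    obtain k where k: "x - s k (z p) \<in> span b"
      using x(1) unfolding span_insert by blast
    moreover have "x - s k (z p) \<in> V"
      using x V' z V by (meson subsetD subspace_diff subspace_scale)
    ultimately have xk: "x = s k (z p)"
      using int by fastforce
    have "k = 0"
    proof (rule ccontr)
      assume "k \<noteq> 0"
      then have "z p = s (1 / k) x"
        using xk by simp
      then show False
        using z(2) x(2) V'(1) subspace_scale by metis
    qed
    then show ?thesis
      using xk by simp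
  qed
  then have "span (insert (z p) b) \<inter> V' = {0}"
    using subspace_0[OF V'(1)] span_zero by blast
  moreover have "\<exists>n\<in>span (insert (z p) b). m - n \<in> V'" if m: "m \<in> M p" for m
  proof -
    obtain n where n: "n \<in> span b" "m - n \<in> V"
      using cov[OF m] by blast
    obtain c where c: "m - n - s c (z p) \<in> V'"
      using V'(3)[OF n(2)] by blast
    have "n \<in> span (insert (z p) b)"
      using n(1) span_mono[of b "insert (z p) b"] by blast
    then have "n + s c (z p) \<in> span (insert (z p) b)"
      by (intro span_add span_scale span_base[of "z p"]) auto
    then show ?thesis
      using c by (intro bexI[of _ "n + s c (z p)"]) (simp_all add: algebra_simps)
  qed
  ultimately show ?thesis
    unfolding decomp_def b_def by simp
qed

text \<open>With the complement fixed, an additional \<open>z p\<close> would be congruent modulo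
  \<open>V\<close> to a combination of the old vectors; as the larger span also meets
  \<open>V\<close> trivially, it would equal that combination. Along a chain, the family active at
  \<open>p\<close> thus stops growing once the complement at \<open>p\<close> is stationary.\<close>

lemma decomp_unique_part:
  assumes E: "decomp p E V" and E': "decomp p E' V" and EE': "E \<subseteq> E'"
    and E'M: "\<And>z. z \<in> E' \<Longrightarrow> z p \<in> M p"
  shows "E' = E"
proof (rule ccontr)
  assume "E' \<noteq> E"
  then obtain z where z: "z \<in> E'" "z \<notin> E"
    using EE' by blast
  obtain n where n: "n \<in> span ((\<lambda>z. z p) ` E)" "z p - n \<in> V"
    using E E'M[OF z(1)] unfolding decomp_def by blast
  have sub: "(\<lambda>z. z p) ` E \<subseteq> (\<lambda>z. z p) ` E' - {z p}"
    using E' z EE' unfolding decomp_def inj_on_def by blast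
  then have n': "n \<in> span ((\<lambda>z. z p) ` E' - {z p})"
    using n(1) span_mono by blast
  then have "n \<in> span ((\<lambda>z. z p) ` E')"
    using span_mono[of "(\<lambda>z. z p) ` E' - {z p}" "(\<lambda>z. z p) ` E'"] by blast
  then have "z p - n \<in> span ((\<lambda>z. z p) ` E')"
    using z(1) by (intro span_diff span_base[of "z p"]) auto
  then have "z p - n = 0"
    using n(2) E' unfolding decomp_def by blast
  then have "z p = n"
    by simp
  then have "dependent ((\<lambda>z. z p) ` E')"
    unfolding dependent_def using n' z(1) by blast
  then show False
    using E' unfolding decomp_def by blast
qed

lemma map_sum:
  assumes "p \<le> q" "finite A" "\<And>i. i \<in> A \<Longrightarrow> a i \<in> M p"
  shows "f p q (\<Sum>i\<in>A. a i) = (\<Sum>i\<in>A. f p q (a i))"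
  using assms(2,3)
proof (induction A rule: finite_induct)
  case empty
  then show ?case
    using assms(1) by simp
next
  case (insert i A)
  have "(\<Sum>i\<in>A. a i) \<in> M p"
    using insert by (intro subspace_sum[OF subspace_M]) auto
  then show ?case
    using insert assms(1) by (simp add: map_add)
qed

end

section \<open>Maximal families of block summands\<close>

context middle_exact_mod
begin

definition block_decomp :: "('s \<times> 't \<Rightarrow> 'v) set \<Rightarrow> ('s \<times> 't \<Rightarrow> 'v set) \<Rightarrow> bool" where
  "block_decomp F C \<longleftrightarrow> (\<forall>z\<in>F. generator z \<and> is_block {q. z q \<noteq> 0}) \<and> submod C \<and>
     (\<forall>p. decomp p {z \<in> F. z p \<noteq> 0} (C p))"

text \<open>A lift \<open>w\<close> in \<open>M\<close> is corrected by its component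
  \<open>n\<close> along the generators. Wherever \<open>w\<close> maps into \<open>C\<close>, the
  image of \<open>n\<close> lies both in \<open>C\<close> and in the span of the generators, hence
  is zero, so the correction leaves the prescribed images unchanged.\<close>

lemma complement_middle_exact_mod:
  assumes "block_decomp F C"
  shows "middle_exact_mod s C f"
proof -
  have C: "submod C" and gen: "\<And>z. z \<in> F \<Longrightarrow> generator z"
    and dec: "\<And>p. decomp p {z \<in> F. z p \<noteq> 0} (C p)"
    using assms unfolding block_decomp_def by auto
  note CD = submodD[OF C]
  interpret C: pers_mod s C f
    by (rule submod_imp_pers_mod[OF C])
  show ?thesis
  proof
    fix x x' :: 's and y y' :: 't and u v
    assume le: "x \<le> x'" "y \<le> y'" and u: "u \<in> C (x, y')" and v: "v \<in> C (x', y)"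
      and uv: "f (x, y') (x', y') u = f (x', y) (x', y') v"
    obtain w where w: "w \<in> M (x, y)" "f (x, y) (x, y') w = u" "f (x, y) (x', y) w = v"
      using exact[OF le CD(2)[OF u] CD(2)[OF v] uv] by blast
    obtain n where n: "n \<in> span ((\<lambda>z. z (x, y)) ` {z \<in> F. z (x, y) \<noteq> 0})" "w - n \<in> C (x, y)"
      using dec[of "(x, y)"] w(1) unfolding decomp_def by blast
    have eq: "f (x, y) q (w - n) = f (x, y) q w" if q: "(x, y) \<le> q" "f (x, y) q w \<in> C q" for q
    proof -
      note g = generator_span[OF gen q(1) n(1)]
      have d: "f (x, y) q (w - n) = f (x, y) q w - f (x, y) q n"
        using q(1) w(1) g(1) by (rule map_diff)
      have "f (x, y) q (w - n) \<in> C q"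
        using CD(3)[OF q(1) n(2)] .
      then have "f (x, y) q w - f (x, y) q (w - n) \<in> C q"
        using q(2) CD(1) subspace_diff by blast
      then have "f (x, y) q n \<in> C q"
        unfolding d by simp
      then have "f (x, y) q n = 0"
        using g(2) dec[of q] unfolding decomp_def by blast
      then show ?thesis
        using d by simp
    qed
    show "\<exists>w\<in>C (x, y). f (x, y) (x, y') w = u \<and> f (x, y) (x', y) w = v"
      using eq[of "(x, y')"] eq[of "(x', y)"] w u v le n(2) by auto
  qed
qed

lemma block_decomp_extend:
  assumes FC: "block_decomp F C" and m: "m \<in> C p" "m \<noteq> 0"
  obtains z C' where "block_decomp (insert z F) C'" "C' \<le> C" "z \<notin> F"
proof -
  interpret C: middle_exact_mod s C f
    by (rule complement_middle_exact_mod[OF FC])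
  obtain z C' where zC': "C.splits z C'" and block: "is_block {q. z q \<noteq> 0}"
    by (rule C.block_splits[OF m])
  have C: "submod C" and F: "\<And>z. z \<in> F \<Longrightarrow> generator z \<and> is_block {q. z q \<noteq> 0}"
    and dec: "\<And>p. decomp p {z \<in> F. z p \<noteq> 0} (C p)"
    using FC unfolding block_decomp_def by auto
  note CD = submodD[OF C]
  have C': "C.submod C'" and zC: "\<And>q. z q \<in> C q" and zf: "\<And>q r. z q \<noteq> 0 \<Longrightarrow> q \<le> r \<Longrightarrow> f q r (z q) = z r"
    and avoid: "\<And>q. z q \<noteq> 0 \<Longrightarrow> z q \<notin> C' q" and cov: "\<And>q m. m \<in> C q \<Longrightarrow> \<exists>c. m - s c (z q) \<in> C' q"
    using zC' unfolding C.splits_def C.generator_def by auto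
  have "submod C'"
    unfolding submod_def
  proof (intro conjI allI impI)
    show "subspace (C' p)" for p
      by (rule C.submodD(1)[OF C'])
    show "C' p \<subseteq> M p" for p
      using C.submodD(2)[OF C'] CD(2) by blast
    show "f p q ` C' p \<subseteq> C' q" if "p \<le> q" for p q
      using C.submodD(3)[OF C' that] by blast
  qed
  moreover have "generator z"
    unfolding generator_def using CD(2)[OF zC] zf by simp
  moreover have "decomp p {y \<in> insert z F. y p \<noteq> 0} (C' p)" for p
  proof (cases "z p = 0")
    case True
    then have "{y \<in> insert z F. y p \<noteq> 0} = {y \<in> F. y p \<noteq> 0}"
      by auto
    moreover have "C' p = C p"
      using C.submodD(2)[OF C', of _ p] cov[of _ p] True by auto
    ultimately show ?thesis
      using dec by simp
  next
    case False
    then have "{y \<in> insert z F. y p \<noteq> 0} = insert z {y \<in> F. y p \<noteq> 0}"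
      by auto
    moreover have "decomp p (insert z {y \<in> F. y p \<noteq> 0}) (C' p)"
    proof (rule decomp_insert[OF dec CD(1)])
      show "z p \<in> C p" "z p \<notin> C' p"
        using zC avoid[OF False] by auto
      show "subspace (C' p)" "C' p \<subseteq> C p"
        using C.submodD(1)[OF C', of p] C.submodD(2)[OF C', of _ p] by auto
      show "\<exists>c. m - s c (z p) \<in> C' p" if "m \<in> C p" for m
        using cov[OF that] .
    qed
    ultimately show ?thesis
      by simp
  qed
  ultimately have "block_decomp (insert z F) C'"
    unfolding block_decomp_def using F block by simp
  moreover have "C' \<le> C"
    by (intro le_funI subsetI) (rule C.submodD(2)[OF C'])
  \<comment> \<open>The extension has to be proper in order to contradict maximality; a member of
    \<open>F\<close> cannot take a non-zero value in the complement.\<close>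
  moreover have "z \<notin> F"
  proof
    assume "z \<in> F"
    obtain q where q: "z q \<noteq> 0"
      using block unfolding is_block_def by blast
    have "z q \<in> span ((\<lambda>z. z q) ` {z \<in> F. z q \<noteq> 0})"
      using q \<open>z \<in> F\<close> by (intro span_base) auto
    then show False
      using dec[of q] zC[of q] q unfolding decomp_def by blast
  qed
  ultimately show ?thesis
    by (rule that)
qed

text \<open>At a given point some pair \<open>(F0, C0)\<close> of the chain has the least
  complement. From there on both the complement and the active part of the family are constant at
  that point, so the union and the intersection agree there with \<open>F0\<close> and
  \<open>C0\<close>.\<close>

lemma block_decomp_chain_bound:
  assumes ne: "\<C> \<noteq> {}" and dec: "\<And>F C. (F, C) \<in> \<C> \<Longrightarrow> block_decomp F C"
    and chain: "\<And>F C F' C'. (F, C) \<in> \<C> \<Longrightarrow> (F', C') \<in> \<C> \<Longrightarrow>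
      F \<subseteq> F' \<and> C' \<le> C \<or> F' \<subseteq> F \<and> C \<le> C'"
  shows "block_decomp (\<Union>(fst ` \<C>)) (\<lambda>q. \<Inter>C\<in>snd ` \<C>. C q)"
proof -
  define U where "U = \<Union>(fst ` \<C>)"
  define K where "K = (\<lambda>q. \<Inter>C\<in>snd ` \<C>. C q)"
  have sub: "submod C" and gen: "\<And>z. z \<in> F \<Longrightarrow> generator z \<and> is_block {q. z q \<noteq> 0}"
    and dc: "\<And>p. decomp p {z \<in> F. z p \<noteq> 0} (C p)" if "(F, C) \<in> \<C>" for F C
    using dec[OF that] unfolding block_decomp_def by auto
  have sub': "submod C" if "C \<in> snd ` \<C>" for C
    using that sub by auto
  have "submod K"
    unfolding submod_def
  proof (intro conjI allI impI)
    fix p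
    show "subspace (K p)"
      unfolding K_def using submodD(1)[OF sub'] by (rule subspace_Int)
    show "K p \<subseteq> M p"
      unfolding K_def using ne submodD(2)[OF sub'] by blast
  next
    fix p q :: "'s \<times> 't" assume "p \<le> q"
    then show "f p q ` K p \<subseteq> K q"
      unfolding K_def using submodD(3)[OF sub'] by blast
  qed
  moreover have "decomp p {z \<in> U. z p \<noteq> 0} (K p)" for p
  proof -
    define \<A> where "\<A> = (\<lambda>C. C p) ` snd ` \<C>"
    have "\<A> \<noteq> {}"
      using ne unfolding \<A>_def by blast
    moreover have "subspace A \<and> A \<subseteq> M p" if "A \<in> \<A>" for A
      using that submodD(1,2)[OF sub'] unfolding \<A>_def by blast
    ultimately obtain A where A: "A \<in> \<A>" "\<forall>A'\<in>\<A>. A' \<subseteq> A \<longrightarrow> A' = A"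
      using subspace_minimal by metis
    then obtain F0 C0 where FC0: "(F0, C0) \<in> \<C>" "A = C0 p"
      unfolding \<A>_def by auto
    have least: "C0 p \<subseteq> C p \<and> {z \<in> F. z p \<noteq> 0} \<subseteq> {z \<in> F0. z p \<noteq> 0}" if FC: "(F, C) \<in> \<C>" for F C
      using chain[OF FC0(1) FC]
    proof
      assume *: "F0 \<subseteq> F \<and> C \<le> C0"
      have "C p \<in> \<A>"
        using FC unfolding \<A>_def by (metis image_eqI snd_conv)
      then have eq: "C p = C0 p"
        using A(2) le_funD[of C C0 p] * FC0(2) by blast
      have "{z \<in> F. z p \<noteq> 0} = {z \<in> F0. z p \<noteq> 0}"
      proof (rule decomp_unique_part)
        show "decomp p {z \<in> F0. z p \<noteq> 0} (C0 p)"
          by (rule dc[OF FC0(1)])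
        show "decomp p {z \<in> F. z p \<noteq> 0} (C0 p)"
          using dc[OF FC, of p] eq by simp
        show "{z \<in> F0. z p \<noteq> 0} \<subseteq> {z \<in> F. z p \<noteq> 0}"
          using * by blast
        show "z p \<in> M p" if "z \<in> {z \<in> F. z p \<noteq> 0}" for z
          using gen[OF FC, of z] that unfolding generator_def by blast
      qed
      then show ?thesis
        using eq by blast
    next
      assume "F \<subseteq> F0 \<and> C0 \<le> C"
      then show ?thesis
        using le_funD[of C0 C p] by blast
    qed
    have "K p = C0 p"
      unfolding K_def using least FC0(1) by fastforce
    moreover have "{z \<in> U. z p \<noteq> 0} = {z \<in> F0. z p \<noteq> 0}"
      unfolding U_def using least FC0(1) by fastforce
    ultimately show ?thesis
      using dc[OF FC0(1), of p] by simp
  qed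
  moreover have "\<forall>z\<in>U. generator z \<and> is_block {q. z q \<noteq> 0}"
    unfolding U_def using gen by fastforce
  ultimately show ?thesis
    unfolding block_decomp_def U_def K_def by blast
qed

lemma block_basis:
  obtains F where "\<And>z. z \<in> F \<Longrightarrow> generator z" "\<And>z. z \<in> F \<Longrightarrow> is_block {q. z q \<noteq> 0}"
    "\<And>p. inj_on (\<lambda>z. z p) {z \<in> F. z p \<noteq> 0}"
    "\<And>p. independent ((\<lambda>z. z p) ` {z \<in> F. z p \<noteq> 0})"
    "\<And>p. span ((\<lambda>z. z p) ` {z \<in> F. z p \<noteq> 0}) = M p"
proof -
  define \<S> where "\<S> = {(F, C). block_decomp F C}"
  define R :: "('s \<times> 't \<Rightarrow> 'v) set \<times> ('s \<times> 't \<Rightarrow> 'v set) \<Rightarrow> _ \<Rightarrow> bool"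
    where "R = (\<lambda>(F, C) (F', C'). F \<subseteq> F' \<and> C' \<le> C)"
  have "\<exists>D\<in>\<S>. \<forall>D'\<in>\<S>. R D D' \<longrightarrow> D' = D"
  proof (rule predicate_Zorn)
    show "partial_order_on \<S> (relation_of R \<S>)"
      by (rule partial_order_on_relation_ofI) (auto simp: R_def)
  next
    fix \<C> assume \<C>: "\<C> \<in> Chains (relation_of R \<S>)"
    show "\<exists>D\<in>\<S>. \<forall>D'\<in>\<C>. R D' D"
    proof (cases "\<C> = {}")
      case True
      have "block_decomp {} M"
        unfolding block_decomp_def using submod_M decomp_M by simp
      then show ?thesis
        using True unfolding \<S>_def by blast
    next
      case False
      have "block_decomp (\<Union>(fst ` \<C>)) (\<lambda>q. \<Inter>C\<in>snd ` \<C>. C q)"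
      proof (rule block_decomp_chain_bound[OF False])
        show "block_decomp F C" if "(F, C) \<in> \<C>" for F C
          using \<C> that unfolding Chains_def relation_of_def \<S>_def by blast
        show "F \<subseteq> F' \<and> C' \<le> C \<or> F' \<subseteq> F \<and> C \<le> C'" if "(F, C) \<in> \<C>" "(F', C') \<in> \<C>" for F C F' C'
          using \<C> that unfolding Chains_def relation_of_def R_def by blast
      qed
      moreover have "R D (\<Union>(fst ` \<C>), \<lambda>q. \<Inter>C\<in>snd ` \<C>. C q)" if "D \<in> \<C>" for D
        using that unfolding R_def by (cases D) (force simp: le_fun_def)
      ultimately show ?thesis
        unfolding \<S>_def by blast
    qed
  qed
  then obtain F C where FC: "block_decomp F C"
    and max: "\<And>F' C'. block_decomp F' C' \<Longrightarrow> F \<subseteq> F' \<Longrightarrow> C' \<le> C \<Longrightarrow> (F', C') = (F, C)"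
    unfolding \<S>_def R_def by auto
  have zero: "m = 0" if m: "m \<in> C p" for m p
  proof (rule ccontr)
    assume "m \<noteq> 0"
    then obtain z C' where "block_decomp (insert z F) C'" "C' \<le> C" "z \<notin> F"
      using block_decomp_extend[OF FC m] by blast
    then show False
      using max[of "insert z F" C'] by blast
  qed
  have gen: "\<And>z. z \<in> F \<Longrightarrow> generator z \<and> is_block {q. z q \<noteq> 0}"
    and dec: "\<And>p. decomp p {z \<in> F. z p \<noteq> 0} (C p)"
    using FC unfolding block_decomp_def by auto
  show ?thesis
  proof (rule that)
    show "span ((\<lambda>z. z p) ` {z \<in> F. z p \<noteq> 0}) = M p" for p
    proof
      show "span ((\<lambda>z. z p) ` {z \<in> F. z p \<noteq> 0}) \<subseteq> M p"
        using generator_span(1)[of F p p] gen by blast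
      show "M p \<subseteq> span ((\<lambda>z. z p) ` {z \<in> F. z p \<noteq> 0})"
      proof
        fix m assume "m \<in> M p"
        then obtain n where "n \<in> span ((\<lambda>z. z p) ` {z \<in> F. z p \<noteq> 0})" "m - n \<in> C p"
          using dec[of p] unfolding decomp_def by blast
        then show "m \<in> span ((\<lambda>z. z p) ` {z \<in> F. z p \<noteq> 0})"
          using zero[of "m - n" p] by simp
      qed
    qed
  qed (use gen dec in \<open>auto simp: decomp_def\<close>)
qed

section \<open>Coordinates with respect to the generators\<close>

lemma block_decomposition:
  "\<exists>(I :: (('s \<times> 't) set \<times> nat) set) \<phi>.
     (\<forall>i\<in>I. is_block (fst i)) \<and>
     pmod_iso s M f dsum_scale (dsum_space I fst) (dsum_map fst) \<phi>"
proof -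
  obtain F where gen: "\<And>z. z \<in> F \<Longrightarrow> generator z"
    and block: "\<And>z. z \<in> F \<Longrightarrow> is_block {q. z q \<noteq> 0}"
    and inj: "\<And>p. inj_on (\<lambda>z. z p) {z \<in> F. z p \<noteq> 0}"
    and ind: "\<And>p. independent ((\<lambda>z. z p) ` {z \<in> F. z p \<noteq> 0})"
    and span: "\<And>p. span ((\<lambda>z. z p) ` {z \<in> F. z p \<noteq> 0}) = M p"
    by (rule block_basis) blast
  define b where "b = (\<lambda>p. (\<lambda>z. z p) ` {z \<in> F. z p \<noteq> 0})"
  have ind_b: "independent (b p)" and span_b: "span (b p) = M p" for p
    using ind span unfolding b_def by auto
  have fin_b: "finite (b p)" for p
  proof -
    obtain B where B: "finite B" "M p \<subseteq> span B"
      using pfd by blast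
    have "b p \<subseteq> span B"
      using span_b[of p] B(2) span_superset by blast
    then show ?thesis
      using independent_span_bound[OF B(1) ind_b] by blast
  qed
  have finF: "finite {z \<in> F. z p \<noteq> 0}" for p
    using fin_b[of p] inj[of p] unfolding b_def by (rule finite_imageD)
  define S where "S = (\<lambda>z :: 's \<times> 't \<Rightarrow> 'v. {q. z q \<noteq> 0})"
  \<comment> \<open>Only finitely many generators share a non-empty support, as their values at any
    of its points are distinct basis vectors of a finite-dimensional space. A natural number
    therefore suffices to tell them apart, which is the second component of the index.\<close>
  have "\<exists>e :: ('s \<times> 't \<Rightarrow> 'v) \<Rightarrow> nat. inj_on e {z \<in> F. S z = B}" for B
  proof (cases "B = {}")
    case True
    then have "{z \<in> F. S z = B} = {}"
      using block unfolding S_def is_block_def by blast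
    then show ?thesis
      using inj_on_empty by metis
  next
    case False
    then obtain p where "p \<in> B"
      by blast
    then have "{z \<in> F. S z = B} \<subseteq> {z \<in> F. z p \<noteq> 0}"
      unfolding S_def by blast
    then have "finite {z \<in> F. S z = B}"
      using finF finite_subset by blast
    then obtain e :: "('s \<times> 't \<Rightarrow> 'v) \<Rightarrow> nat" where "inj_on e {z \<in> F. S z = B}"
      using finite_imp_inj_to_nat_seg by metis
    then show ?thesis
      by blast
  qed
  then obtain e :: "('s \<times> 't) set \<Rightarrow> ('s \<times> 't \<Rightarrow> 'v) \<Rightarrow> nat"
    where e: "\<And>B. inj_on (e B) {z \<in> F. S z = B}"
    by metis
  define g where "g = (\<lambda>z. (S z, e (S z) z))"
  have inj_g: "inj_on g F"
    using e unfolding g_def inj_on_def by auto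
  define I where "I = g ` F"
  define Z where "Z = inv_into F g"
  have ZF: "Z i \<in> F" and gZ: "g (Z i) = i" if "i \<in> I" for i
    using that unfolding Z_def I_def by (auto simp: inv_into_into f_inv_into_f)
  have supp: "Z i p \<noteq> 0 \<longleftrightarrow> p \<in> fst i" if "i \<in> I" for i p
    using gZ[OF that] unfolding g_def S_def by (metis (mono_tags) fst_conv mem_Collect_eq)
  have ZM: "Z i p \<in> M p" if "i \<in> I" for i p
    using gen[OF ZF[OF that]] unfolding generator_def by blast
  have Zf: "f p q (Z i p) = Z i q" if "i \<in> I" "p \<in> fst i" "p \<le> q" for i p q
    using gen[OF ZF[OF that(1)]] supp[OF that(1), of p] that unfolding generator_def by blast
  define Ip where "Ip = (\<lambda>p. {i \<in> I. p \<in> fst i})"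
  have bij: "bij_betw (\<lambda>i. Z i p) (Ip p) (b p)" for p
  proof (rule bij_betw_imageI)
    show "inj_on (\<lambda>i. Z i p) (Ip p)"
    proof (rule inj_onI)
      fix i j assume ij: "i \<in> Ip p" "j \<in> Ip p" "Z i p = Z j p"
      then have "Z i \<in> {z \<in> F. z p \<noteq> 0}" "Z j \<in> {z \<in> F. z p \<noteq> 0}"
        using ZF supp unfolding Ip_def by auto
      then have "Z i = Z j"
        using inj[of p] ij(3) unfolding inj_on_def by blast
      then show "i = j"
        using gZ ij unfolding Ip_def by (metis (mono_tags, lifting) mem_Collect_eq)
    qed
    show "(\<lambda>i. Z i p) ` Ip p = b p"
    proof (intro subset_antisym subsetI)
      fix v assume "v \<in> (\<lambda>i. Z i p) ` Ip p"
      then show "v \<in> b p"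
        using ZF supp unfolding b_def Ip_def by blast
    next
      fix v assume "v \<in> b p"
      then obtain z where z: "z \<in> F" "z p \<noteq> 0" "v = z p"
        unfolding b_def by blast
      then have "g z \<in> I" "Z (g z) = z"
        unfolding I_def Z_def using inj_g by auto
      moreover from this have "g z \<in> Ip p"
        using supp[of "g z" p] z unfolding Ip_def by simp
      ultimately show "v \<in> (\<lambda>i. Z i p) ` Ip p"
        using z by force
    qed
  qed
  have finI: "finite (Ip p)" for p
    using bij_betw_finite[OF bij] fin_b by blast
  define \<phi> :: "'s \<times> 't \<Rightarrow> 'v \<Rightarrow> ('s \<times> 't) set \<times> nat \<Rightarrow> 'k"
    where "\<phi> = (\<lambda>p x i. if i \<in> Ip p then representation (b p) x (Z i p) else 0)"
  \<comment> \<open>Compatibility with the structure maps is proved for this inverse of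
    \<open>\<phi>\<close>, where it follows from the action of \<open>f\<close> on generators, and
    then transferred to \<open>\<phi>\<close>.\<close>
  define \<psi> where "\<psi> = (\<lambda>p y. \<Sum>i\<in>Ip p. s (y i) (Z i p))"
  have dsum: "y \<in> dsum_space I fst p \<longleftrightarrow> (\<forall>i. y i \<noteq> 0 \<longrightarrow> i \<in> Ip p)"
    for p and y :: "('s \<times> 't) set \<times> nat \<Rightarrow> 'k"
  proof -
    have "finite {i. y i \<noteq> 0}" if "\<forall>i. y i \<noteq> 0 \<longrightarrow> i \<in> Ip p"
      using that by (intro finite_subset[OF _ finI[of p]]) auto
    then show ?thesis
      unfolding dsum_space_def Ip_def by auto
  qed
  have \<psi>M: "\<psi> p y \<in> M p" for p y
    unfolding \<psi>_def Ip_def by (intro subspace_sum[OF subspace_M] M_scale ZM) auto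
  have \<psi>\<phi>: "\<psi> p (\<phi> p x) = x" if "x \<in> M p" for p x
  proof -
    have "\<psi> p (\<phi> p x) = (\<Sum>i\<in>Ip p. s (representation (b p) x (Z i p)) (Z i p))"
      unfolding \<psi>_def \<phi>_def by (intro sum.cong) auto
    also have "\<dots> = (\<Sum>v\<in>b p. s (representation (b p) x v) v)"
      by (rule sum.reindex_bij_betw[OF bij])
    also have "\<dots> = x"
      using that span_b by (intro sum_representation_eq[OF ind_b _ fin_b]) auto
    finally show ?thesis .
  qed
  have \<phi>\<psi>: "\<phi> p (\<psi> p y) = y" if y: "y \<in> dsum_space I fst p" for p y
  proof
    fix i
    show "\<phi> p (\<psi> p y) i = y i"
    proof (cases "i \<in> Ip p")
      case True
      have Zb: "Z j p \<in> b p" if "j \<in> Ip p" for j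
        using bij_betw_apply[OF bij that] .
      have "representation (b p) (\<psi> p y) = (\<lambda>v. \<Sum>j\<in>Ip p. representation (b p) (s (y j) (Z j p)) v)"
        unfolding \<psi>_def using Zb by (intro representation_sum[OF ind_b] span_scale span_base)
      then have "representation (b p) (\<psi> p y) (Z i p)
          = (\<Sum>j\<in>Ip p. representation (b p) (s (y j) (Z j p)) (Z i p))"
        by simp
      also have "\<dots> = (\<Sum>j\<in>Ip p. if j = i then y j else 0)"
      proof (rule sum.cong[OF refl])
        fix j assume j: "j \<in> Ip p"
        have "Z i p = Z j p \<longleftrightarrow> j = i"
          using bij_betw_imp_inj_on[OF bij[of p]] j True unfolding inj_on_def by blast
        then show "representation (b p) (s (y j) (Z j p)) (Z i p) = (if j = i then y j else 0)"
          using Zb[OF j] ind_b[of p]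
          by (simp add: representation_scale representation_basis span_base)
      qed
      also have "\<dots> = y i"
        using True finI by simp
      finally show ?thesis
        unfolding \<phi>_def using True by simp
    next
      case False
      then have "y i = 0"
        using y unfolding dsum by blast
      then show ?thesis
        unfolding \<phi>_def using False by simp
    qed
  qed
  have \<phi>D: "\<phi> p x \<in> dsum_space I fst p" for p x
    unfolding dsum \<phi>_def by simp
  have nat: "f p q (\<psi> p y) = \<psi> q (dsum_map fst p q y)" and dm: "dsum_map fst p q y \<in> dsum_space I fst q"
    if pq: "p \<le> q" and y: "y \<in> dsum_space I fst p" for p q y
  proof -
    have y0: "y i = 0" if "i \<notin> Ip p" for i
      using y that unfolding dsum by blast
    show "dsum_map fst p q y \<in> dsum_space I fst q"
      unfolding dsum
    proof (intro allI impI)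
      fix i assume "dsum_map fst p q y i \<noteq> 0"
      then have "q \<in> fst i" "y i \<noteq> 0"
        unfolding dsum_map_def by (auto split: if_splits)
      then show "i \<in> Ip q"
        using y0[of i] unfolding Ip_def by blast
    qed
    have "f p q (\<psi> p y) = (\<Sum>i\<in>Ip p. f p q (s (y i) (Z i p)))"
      unfolding \<psi>_def using ZM by (intro map_sum[OF pq finI] M_scale) (auto simp: Ip_def)
    also have "\<dots> = (\<Sum>i\<in>Ip p. s (y i) (Z i q))"
      using ZM Zf pq by (intro sum.cong) (auto simp: Ip_def map_scale)
    \<comment> \<open>The two index sets are compared through their union: a summand born after
      \<open>p\<close> has coefficient zero, and one that is dead at \<open>q\<close> has
      \<open>Z i q = 0\<close>.\<close>
    also have "\<dots> = (\<Sum>i\<in>Ip p \<union> Ip q. s (y i) (Z i q))"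
      using y0 finI by (intro sum.mono_neutral_left) auto
    also have "\<dots> = (\<Sum>i\<in>Ip q. s (y i) (Z i q))"
      using supp[of _ q] finI[of p] finI[of q] by (intro sum.mono_neutral_right) (auto simp: Ip_def)
    also have "\<dots> = \<psi> q (dsum_map fst p q y)"
      unfolding \<psi>_def dsum_map_def by (intro sum.cong) (auto simp: Ip_def)
    finally show "f p q (\<psi> p y) = \<psi> q (dsum_map fst p q y)" .
  qed
  have "pmod_iso s M f dsum_scale (dsum_space I fst) (dsum_map fst) \<phi>"
    unfolding pmod_iso_def
  proof (intro conjI allI impI ballI)
    fix p
    show "bij_betw (\<phi> p) (M p) (dsum_space I fst p)"
      by (rule bij_betw_byWitness[of _ "\<psi> p"]) (use \<psi>\<phi>[of _ p] \<phi>\<psi>[of _ p] \<psi>M[of p] \<phi>D[of p] in auto)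
    show "lin_on s dsum_scale (M p) (\<phi> p)"
      unfolding lin_on_def \<phi>_def dsum_scale_def using ind_b[of p] span_b[of p]
      by (auto simp: fun_eq_iff representation_add representation_scale)
  next
    fix p q x assume pq: "p \<le> q" and x: "x \<in> M p"
    have "\<phi> q (f p q x) = \<phi> q (f p q (\<psi> p (\<phi> p x)))"
      using \<psi>\<phi>[OF x] by simp
    also have "\<dots> = \<phi> q (\<psi> q (dsum_map fst p q (\<phi> p x)))"
      using nat[OF pq \<phi>D] by simp
    also have "\<dots> = dsum_map fst p q (\<phi> p x)"
      using \<phi>\<psi>[OF dm[OF pq \<phi>D]] .
    finally show "\<phi> q (f p q x) = dsum_map fst p q (\<phi> p x)" .
  qed
  moreover have "is_block (fst i)" if "i \<in> I" for i
    using that block unfolding I_def g_def S_def by auto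
  ultimately show ?thesis
    by blast
qed

end

theorem theorem1p3:
  fixes s :: "'k::field \<Rightarrow> 'v::ab_group_add \<Rightarrow> 'v"
    and M :: "'s::linorder \<times> 't::linorder \<Rightarrow> 'v set"
    and f :: "'s \<times> 't \<Rightarrow> 's \<times> 't \<Rightarrow> 'v \<Rightarrow> 'v"
  assumes "pmod s M f" and "pfd s M" and "middle_exact M f"
  shows "\<exists>(I :: (('s \<times> 't) set \<times> nat) set) \<phi>.
           (\<forall>i\<in>I. is_block (fst i)) \<and>
           pmod_iso s M f dsum_scale (dsum_space I fst) (dsum_map fst) \<phi>"
proof -
  note pm = assms(1)[unfolded pmod_def]
  interpret vector_space s
    by (rule conjunct1[OF pm])
  have lin: "f p q ` M p \<subseteq> M q" "lin_on s s (M p) (f p q)" if "p \<le> q" for p q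
    using pm[THEN conjunct2, THEN conjunct2, THEN conjunct1] that by metis+
  interpret middle_exact_mod s M f
  proof
    show "subspace (M p)" for p
      using pm[THEN conjunct2, THEN conjunct1] by metis
    show "f p q x \<in> M q" if "p \<le> q" "x \<in> M p" for p q x
      using lin(1)[OF that(1)] that(2) by blast
    show "f p q (x + y) = f p q x + f p q y" if "p \<le> q" "x \<in> M p" "y \<in> M p" for p q x y
      using lin(2)[OF that(1)] that(2,3) unfolding lin_on_def by blast
    show "f p q (s c x) = s c (f p q x)" if "p \<le> q" "x \<in> M p" for p q c x
      using lin(2)[OF that(1)] that(2) unfolding lin_on_def by blast
    show "f p p x = x" if "x \<in> M p" for p x
      using pm[THEN conjunct2, THEN conjunct2, THEN conjunct2, THEN conjunct1] that by metis
    show "f q r (f p q x) = f p r x" if "p \<le> q" "q \<le> r" "x \<in> M p" for p q r x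
      using pm[THEN conjunct2, THEN conjunct2, THEN conjunct2, THEN conjunct2] that by metis
    show "\<exists>B. finite B \<and> M p \<subseteq> span B" for p
      using assms(2) unfolding pfd_def by (metis order_refl)
  next
    fix x x' :: 's and y y' :: 't and u v
    assume *: "x \<le> x'" "y \<le> y'" "u \<in> M (x, y')" "v \<in> M (x', y)"
      "f (x, y') (x', y') u = f (x', y) (x', y') v"
    have "{(u, v). u \<in> M (x, y') \<and> v \<in> M (x', y) \<and> f (x, y') (x', y') u - f (x', y) (x', y') v = 0}
        = (\<lambda>w. (f (x, y) (x, y') w, f (x, y) (x', y) w)) ` M (x, y)"
      using assms(3) *(1,2) unfolding middle_exact_def Let_def by blast
    then have "(u, v) \<in> (\<lambda>w. (f (x, y) (x, y') w, f (x, y) (x', y) w)) ` M (x, y)"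
      using *(3-5) by auto
    then show "\<exists>w\<in>M (x, y). f (x, y) (x, y') w = u \<and> f (x, y) (x', y) w = v"
      by auto
  qed
  show ?thesis
    by (rule block_decomposition)
qed

end
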